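(* For all integers $d$ and $k$ with $0 \leq k \leq d-2$ and for $\varepsilon \in (0,1)$, there is an $r=r(d,\varepsilon,k) \in \mathbb{N}$ such that for all positive integers $n$ and $m$ there is a set $P$ of $n$ points in $\mathbb{R}^d$ and an arrangement $\mathcal{H}$ of $m$ hyperplanes in $\mathbb{R}^d$ such that $K_{r,r} \not\subseteq G(P,\mathcal{H})$ and the number of incidences between $P$ and $\mathcal{H}$ satisfies \[\mathrm{inc}(P,\mathcal{H}) \geq \Omega_{d,\varepsilon,k}\left(n^{1-(k+1)/((k+2-1/d)(d-k))-\varepsilon}m^{1-(d-1)/(dk+2d-1)-\varepsilon}\right).\]
   Context: An incidence between a point set $P$ and a hyperplane arrangement $\mathcal{H}$ is a pair $(p,H)$ with $p\in P$, $H\in\mathcal{H}$, $p\in H$; $\mathrm{inc}(P,\mathcal{H})$ denotes the number of incidences. $G(P,\mathcal{H})$ is the bipartite incidence graph on $P\cup\mathcal{H}$ with edges $\{p,H\}$ for incidences $(p,H)$. $\Omega_{d,\varepsilon,k}$ hides constants depending on $d,\varepsilon,k$. *)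

theory Defs
  imports "HOL-Analysis.Analysis"
begin

definition is_hyperplane :: "(real ^ 'n) set \<Rightarrow> bool" where
  "is_hyperplane S \<longleftrightarrow> (\<exists>a b. a \<noteq> 0 \<and> S = {x. a \<bullet> x = b})"

definition inc :: "'a set \<Rightarrow> 'a set set \<Rightarrow> nat" where
  "inc P H = card {(p, h). p \<in> P \<and> h \<in> H \<and> p \<in> h}"

definition contains_Krr :: "nat \<Rightarrow> 'a set \<Rightarrow> 'a set set \<Rightarrow> bool" where
  "contains_Krr r P H \<longleftrightarrow>
     (\<exists>A B. A \<subseteq> P \<and> B \<subseteq> H \<and> card A = r \<and> card B = r \<and> (\<forall>p\<in>A. \<forall>h\<in>B. p \<in> h))"

end

theory Submission
  imports Defs "HOL-Number_Theory.Number_Theory"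
begin

text \<open>The points are lifts of a subset of \<open>{0..<p}\<^sup>d\<close> that meets every \<open>k\<close>-flat modulo a prime \<open>p\<close> in
  few points; a random subset of density about \<open>p\<close> to the power \<open>-k\<close> works. Independence modulo \<open>p\<close>
  implies independence over the reals, so few of these points lie on a real \<open>k\<close>-flat. The normals
  come from a similar subset of \<open>{0..<q}\<close> to the power \<open>d - 1\<close>, viewed as an affine chart of
  projective space modulo \<open>q\<close>: by Dirichlet's theorem every projective point modulo \<open>q\<close> has an
  integer representative of size \<open>O(q powr ((d - 1) / d))\<close>, and few of these lie in a real subspace
  of dimension \<open>d - k - 1\<close>. The hyperplanes are all translates of these normals through the
  points. Points that span at least a \<open>(k + 1)\<close>-flat leave at most \<open>d - k - 1\<close> dimensions for the
  normals of the hyperplanes containing all of them, so there is no large complete bipartite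
  subgraph. Since the inner products are small integers, there are few hyperplanes, while every
  point lies on one hyperplane per normal.\<close>

section \<open>Random subsets evading a family of small sets\<close>

text \<open>The exponents come from one equation. The points lie in a box of side about n^(1/(d-k)),
  and w normals have entries of size about w^((d-1)/(d(k+1))), so the arrangement has about n^a
  w^(1+b) members with a = 1/(d-k) and b = (d-1)/(d(k+1)). Setting this equal to m gives n w = n
  (m/n^a)^(1/(1+b)) incidences, and 1/(1+b) = 1 - (d-1)/(dk+2d-1). When m is too small for a single
  normal, the claimed bound is at most linear in n and a trivial configuration reaches it. Working
  modulo a prime makes the family of flats finite, of size polynomial in p. At density exactly
  p^(-k) a flat would be expected to hold a bounded number of chosen points, and the union bound
  would fail for constant r; an extra factor p^(-delta) makes r points in one flat cost p^(-delta
  r), so some r of order 1/delta suffices. This is where r depends on epsilon. For a normal only the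
  direction counts. The freedom to rescale it modulo the prime is what shortens it, and this saves
  the factor (d-1)/d in b.\<close>

lemma card_monochromatic_le:
  assumes X: "finite X" and E: "E \<subseteq> X" "E \<noteq> {}"
  shows "card {f \<in> X \<rightarrow>\<^sub>E {..<q::nat}. \<exists>c. \<forall>x\<in>E. f x = c} \<le> q ^ (card X - card E + 1)"
proof -
  obtain e where e: "e \<in> E" using E by auto
  \<comment> \<open>A colouring constant on \<open>E\<close> is determined by its values off
    \<open>E\<close> and at the single point \<open>e\<close>, so restriction to \<open>Y\<close>
    loses nothing.\<close>
  define Y where "Y = X - (E - {e})"
  let ?M = "{f \<in> X \<rightarrow>\<^sub>E {..<q}. \<exists>c. \<forall>x\<in>E. f x = c}"
  have fE: "finite E" using X E finite_subset by blast
  have cE: "card E > 0" using fE E by (simp add: card_gt_0_iff)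
  have "card (E - {e}) = card E - 1" using e fE by simp
  moreover have "card Y = card X - card (E - {e})"
    unfolding Y_def using fE E by (intro card_Diff_subset) auto
  moreover have "card E \<le> card X" using X E by (simp add: card_mono)
  ultimately have cY: "card Y = card X - card E + 1" using cE by linarith
  have "inj_on (\<lambda>f. restrict f Y) ?M"
  proof (rule inj_onI)
    fix f g assume f: "f \<in> ?M" and g: "g \<in> ?M" and eq: "restrict f Y = restrict g Y"
    have Yeq: "f x = g x" if "x \<in> Y" for x using eq that by (metis restrict_apply')
    have eY: "e \<in> Y" using e E unfolding Y_def by auto
    show "f = g"
    proof
      fix x
      consider "x \<notin> X" | "x \<in> Y" | "x \<in> E" using Y_def by blast
      then show "f x = g x"
      proof cases
        case 1
        then show ?thesis using f g PiE_arb[of _ X] by (metis (no_types, lifting) mem_Collect_eq)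
      next
        case 2
        then show ?thesis by (rule Yeq)
      next
        case 3
        obtain c c' where "\<forall>x\<in>E. f x = c" "\<forall>x\<in>E. g x = c'" using f g by blast
        then have "f x = f e" "g x = g e" using 3 e by simp_all
        then show ?thesis using Yeq[OF eY] by simp
      qed
    qed
  qed
  moreover have "(\<lambda>f. restrict f Y) ` ?M \<subseteq> Y \<rightarrow>\<^sub>E {..<q}"
  proof (rule image_subsetI)
    fix f assume "f \<in> ?M"
    then have "\<forall>x\<in>Y. f x \<in> {..<q}" unfolding Y_def by (blast dest: PiE_mem)
    then show "restrict f Y \<in> Y \<rightarrow>\<^sub>E {..<q}" by simp
  qed
  moreover have "finite (Y \<rightarrow>\<^sub>E {..<q})"
    unfolding Y_def using X by (intro finite_PiE) auto
  ultimately have "card ?M \<le> card (Y \<rightarrow>\<^sub>E {..<q})" by (rule card_inj_on_le)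
  also have "\<dots> = q ^ (card X - card E + 1)"
    using X cY by (simp add: card_PiE Y_def)
  finally show ?thesis .
qed

lemma sum_card_fibres:
  fixes q :: nat
  assumes "finite X" "\<And>x. x \<in> X \<Longrightarrow> f x < q"
  shows "(\<Sum>c<q. card {x \<in> X. f x = c}) = card X"
proof -
  have "card X = card (\<Union>c<q. {x \<in> X. f x = c})"
    using assms by (intro arg_cong[where f = card]) auto
  also have "\<dots> = (\<Sum>c<q. card {x \<in> X. f x = c})"
    using assms by (intro card_UN_disjoint) auto
  finally show ?thesis by simp
qed

text \<open>Average over all colourings of \<open>X\<close> with \<open>q\<close> colours the number of points minus the number
  of monochromatic bad sets, pick the best colour class, and delete one point per bad set.\<close>

lemma exists_large_independent_set:
  fixes X :: "'a set" and q r :: nat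
  assumes X: "finite X" and q: "q > 0" and r: "r > 0"
    and Bad: "\<And>E. E \<in> Bad \<Longrightarrow> E \<subseteq> X \<and> card E = r"
    and small: "2 * card Bad \<le> card X * q ^ (r - 1)"
  shows "\<exists>S\<subseteq>X. card X \<le> 2 * q * card S \<and> (\<forall>E\<in>Bad. \<not> E \<subseteq> S)"
proof (cases "Bad = {}")
  case True
  then show ?thesis using q by (intro exI[of _ X]) auto
next
  case False
  define mono where "mono f = {E \<in> Bad. \<exists>c. \<forall>x\<in>E. f x = c}" for f :: "'a \<Rightarrow> nat"
  define \<Omega> where "\<Omega> = X \<rightarrow>\<^sub>E {..<q}"
  have fBad: "finite Bad" using Bad X by (meson Pow_iff finite_Pow_iff rev_finite_subset subsetI)
  have f\<Omega>: "finite \<Omega>" unfolding \<Omega>_def using X by (intro finite_PiE) auto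
  have c\<Omega>: "card \<Omega> = q ^ card X" unfolding \<Omega>_def using X by (simp add: card_PiE)
  have ne: "E \<noteq> {}" if "E \<in> Bad" for E using Bad[OF that] r by auto
  have rX: "r \<le> card X" using False Bad X by (metis all_not_in_conv card_mono)
  \<comment> \<open>Double counting of pairs of a colouring and a bad set monochromatic under it;
    \<open>small\<close> then bounds the average number of such sets by half of
    \<open>card X\<close>.\<close>
  have "(\<Sum>f\<in>\<Omega>. card (mono f)) = (\<Sum>E\<in>Bad. card {f \<in> \<Omega>. \<exists>c. \<forall>x\<in>E. f x = c})"
    unfolding mono_def using f\<Omega> fBad by (rule sum_multicount_gen) auto
  also have "\<dots> \<le> (\<Sum>E\<in>Bad. q ^ (card X - r + 1))"
  proof (rule sum_mono)
    fix E assume E: "E \<in> Bad"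
    show "card {f \<in> \<Omega>. \<exists>c. \<forall>x\<in>E. f x = c} \<le> q ^ (card X - r + 1)"
      using card_monochromatic_le[OF X, of E q] Bad[OF E] ne[OF E] unfolding \<Omega>_def by simp
  qed
  finally have "(\<Sum>f\<in>\<Omega>. card (mono f)) \<le> card Bad * q ^ (card X - r + 1)" by simp
  then have "2 * (\<Sum>f\<in>\<Omega>. card (mono f)) \<le> (2 * card Bad) * q ^ (card X - r + 1)" by simp
  also have "\<dots> \<le> (card X * q ^ (r - 1)) * q ^ (card X - r + 1)"
    using small by (rule mult_right_mono) simp
  also have "\<dots> = card X * card \<Omega>"
  proof -
    have "r - 1 + (card X - r + 1) = card X" using r rX by linarith
    then show ?thesis unfolding c\<Omega> by (metis mult.assoc power_add)
  qed
  finally have le: "(\<Sum>f\<in>\<Omega>. 2 * card (mono f)) \<le> (\<Sum>f\<in>\<Omega>. card X)"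
    by (simp add: sum_distrib_left mult.commute)
  have "\<exists>f\<in>\<Omega>. 2 * card (mono f) \<le> card X"
  proof (rule ccontr)
    assume "\<not> ?thesis"
    then have "(\<Sum>f\<in>\<Omega>. card X) < (\<Sum>f\<in>\<Omega>. 2 * card (mono f))"
      using f\<Omega> c\<Omega> q by (intro sum_strict_mono) auto
    then show False using le by simp
  qed
  then obtain f where f: "f \<in> \<Omega>" "2 * card (mono f) \<le> card X" by blast
  define Xc where "Xc c = {x \<in> X. f x = c}" for c
  define Mc where "Mc c = {E \<in> Bad. \<forall>x\<in>E. f x = c}" for c
  have fq: "f x < q" if "x \<in> X" for x using f that unfolding \<Omega>_def by auto
  have sX: "(\<Sum>c<q. card (Xc c)) = card X"
    unfolding Xc_def using X fq by (rule sum_card_fibres)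
  have "(\<Sum>c<q. card (Mc c)) = card (\<Union>c<q. Mc c)"
  proof (rule card_UN_disjoint[symmetric])
    show "\<forall>i\<in>{..<q}. \<forall>j\<in>{..<q}. i \<noteq> j \<longrightarrow> Mc i \<inter> Mc j = {}"
    proof (intro ballI impI equals0I)
      fix i j E assume ij: "i \<noteq> j" and E: "E \<in> Mc i \<inter> Mc j"
      then obtain x where "x \<in> E" using ne[of E] unfolding Mc_def by auto
      then show False using ij E unfolding Mc_def by auto
    qed
  qed (auto simp: Mc_def fBad)
  also have "\<dots> \<le> card (mono f)"
    unfolding Mc_def mono_def using fBad by (intro card_mono) auto
  finally have sM: "2 * (\<Sum>c<q. card (Mc c)) \<le> card X" using f(2) by linarith
  \<comment> \<open>Averaging over colours: the classes hold \<open>card X\<close> points and at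
    most half as many monochromatic bad sets in total, so in some class the points outnumber the bad
    sets by at least \<open>card X / (2 * q)\<close>.\<close>
  have "\<exists>c<q. card X + 2 * q * card (Mc c) \<le> 2 * q * card (Xc c)"
  proof (rule ccontr)
    assume "\<not> ?thesis"
    then have "(\<Sum>c<q. 2 * q * card (Xc c)) < (\<Sum>c<q. card X + 2 * q * card (Mc c))"
      using q by (intro sum_strict_mono) auto
    also have "\<dots> = q * card X + q * (2 * (\<Sum>c<q. card (Mc c)))"
      by (simp add: sum.distrib sum_distrib_left mult.assoc mult.left_commute)
    also have "\<dots> \<le> q * card X + q * card X" using sM by simp
    also have "\<dots> = (\<Sum>c<q. 2 * q * card (Xc c))"
      using sX by (simp add: sum_distrib_left[symmetric])
    finally show False by simp
  qed
  then obtain c where c: "card X + 2 * q * card (Mc c) \<le> 2 * q * card (Xc c)" by blast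
  define pt where "pt E = (SOME x. x \<in> E)" for E :: "'a set"
  have pt: "pt E \<in> E" if "E \<in> Bad" for E using ne[OF that] unfolding pt_def by (simp add: some_in_eq)
  define S where "S = Xc c - pt ` Mc c"
  have "card (Xc c) - card (pt ` Mc c) \<le> card S"
    unfolding S_def by (rule diff_card_le_card_Diff) (simp add: Mc_def fBad)
  moreover have "card (pt ` Mc c) \<le> card (Mc c)" by (rule card_image_le) (simp add: Mc_def fBad)
  ultimately have "card (Xc c) \<le> card S + card (Mc c)" by linarith
  then have "2 * q * card (Xc c) \<le> 2 * q * card S + 2 * q * card (Mc c)"
    by (metis add_mult_distrib2 mult_le_mono2)
  then have "card X \<le> 2 * q * card S" using c by linarith
  moreover have "\<not> E \<subseteq> S" if E: "E \<in> Bad" for E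
  proof
    assume "E \<subseteq> S"
    then have "E \<in> Mc c" using E unfolding S_def Mc_def Xc_def by auto
    then show False using pt[OF E] \<open>E \<subseteq> S\<close> unfolding S_def by auto
  qed
  moreover have "S \<subseteq> X" unfolding S_def Xc_def by blast
  ultimately show ?thesis by blast
qed

text \<open>The bad sets are the \<open>r\<close>-subsets of members of \<open>\<F>\<close>, at most
  \<open>A ^ r\<close> per member; avoiding all of them means meeting each member in fewer than
  \<open>r\<close> points.\<close>

lemma exists_evasive_subset:
  fixes X :: "'a set" and q r A :: nat
  assumes X: "finite X" and q: "q > 0" and r: "r > 0" and fF: "finite \<F>"
    and A: "\<And>F. F \<in> \<F> \<Longrightarrow> F \<subseteq> X \<and> card F \<le> A"
    and small: "2 * card \<F> * A ^ r \<le> card X * q ^ (r - 1)"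
  shows "\<exists>S\<subseteq>X. card X \<le> 2 * q * card S \<and> (\<forall>F\<in>\<F>. card (F \<inter> S) < r)"
proof -
  define Bad where "Bad = (\<Union>F\<in>\<F>. {E. E \<subseteq> F \<and> card E = r})"
  have fin: "finite F" if "F \<in> \<F>" for F using A[OF that] X finite_subset by blast
  have "card Bad \<le> (\<Sum>F\<in>\<F>. card {E. E \<subseteq> F \<and> card E = r})"
    unfolding Bad_def by (rule card_UN_le[OF fF])
  also have "\<dots> \<le> (\<Sum>F\<in>\<F>. A ^ r)"
  proof (rule sum_mono)
    fix F assume F: "F \<in> \<F>"
    have "card {E. E \<subseteq> F \<and> card E = r} = card F choose r" using fin[OF F] by (rule n_subsets)
    also have "\<dots> \<le> card F ^ r"
      by (cases "r \<le> card F") (simp_all add: binomial_le_pow binomial_eq_0)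
    also have "\<dots> \<le> A ^ r" using A[OF F] by (simp add: power_mono)
    finally show "card {E. E \<subseteq> F \<and> card E = r} \<le> A ^ r" .
  qed
  finally have cB: "2 * card Bad \<le> card X * q ^ (r - 1)" using small by simp
  have B: "E \<subseteq> X \<and> card E = r" if "E \<in> Bad" for E using that A unfolding Bad_def by auto
  obtain S where S: "S \<subseteq> X" "card X \<le> 2 * q * card S" "\<forall>E\<in>Bad. \<not> E \<subseteq> S"
    using exists_large_independent_set[OF X q r B cB] by metis
  have "card (F \<inter> S) < r" if F: "F \<in> \<F>" for F
  proof (rule ccontr)
    assume "\<not> ?thesis"
    then obtain E where "E \<subseteq> F \<inter> S" "card E = r"
      by (metis not_less obtain_subset_with_card_n)
    moreover from this have "E \<in> Bad" using F unfolding Bad_def by auto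
    ultimately show False using S(3) by blast
  qed
  then show ?thesis using S by blast
qed

section \<open>A weak form of Bertrand's postulate\<close>

text \<open>Induction along the Leibniz harmonic triangle:
  $1/((k+1)\binom{N}{k+1}) = 1/(k\binom{N-1}{k}) - 1/(k\binom{N}{k})$.\<close>

lemma mult_binomial_dvd_common_multiple:
  fixes M :: nat
  assumes "\<And>i. 1 \<le> i \<Longrightarrow> i \<le> N \<Longrightarrow> i dvd M" "1 \<le> k" "k \<le> N"
  shows "k * (N choose k) dvd M"
  using assms(2,1,3)
proof (induction k arbitrary: N rule: dec_induct)
  case base
  then show ?case by simp
next
  case (step k)
  define A B where "A = N choose k" and "B = (N - 1) choose k"
  have "k * A dvd M" unfolding A_def using step by simp
  then obtain u where u: "M = k * A * u" by (auto elim: dvdE)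
  have "k * B dvd M" unfolding B_def using step by simp
  then obtain v where v: "M = k * B * v" by (auto elim: dvdE)
  have pos: "A > 0" "B > 0" "k > 0" unfolding A_def B_def using step by auto
  have c: "Suc k * (N choose Suc k) = N * B" unfolding B_def by (rule binomial_absorption)
  have "(N - k) * A = N * B" unfolding A_def B_def by (rule binomial_absorb_comp)
  then have e: "int N * int A - int k * int A = int N * int B"
    using step by (metis Suc_leD int_ops(7) left_diff_distrib of_nat_diff)
  \<comment> \<open>\<open>u\<close> and \<open>v\<close> are \<open>M\<close> times the two
    reciprocals on the right of the harmonic identity, so \<open>v - u\<close> is the cofactor
    sought. The factor \<open>k * A\<close> clears denominators and is cancelled at the end.\<close>
  have "int M * (int k * int A) = int N * (int A - int B) * int M"
    using e by (simp add: algebra_simps)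
  also have "\<dots> = int N * int A * (int k * int B * int v) - int N * int B * (int k * int A * int u)"
    using u v by (metis (no_types) int_ops(7) left_diff_distrib mult.assoc mult.commute)
  also have "\<dots> = int N * int B * (int v - int u) * (int k * int A)"
    by (simp add: algebra_simps)
  finally have "int M = int (N * B) * (int v - int u)" using pos by simp
  then have "int (N * B) dvd int M" by (metis dvd_triv_left)
  then show ?case unfolding c by (simp only: of_nat_dvd_iff)
qed

text \<open>\<open>M\<close> is the least common multiple of \<open>1..2n\<close>. Each prime
  contributes a power of at most \<open>2 * n\<close> and at most \<open>x\<close> primes occur, so
  \<open>M\<close> is at most \<open>(2 * n) ^ x\<close>; yet \<open>M\<close> is a multiple of
  \<open>n * ((2 * n) choose n)\<close>, which is at least \<open>4 ^ n / 2\<close>. Used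
  contrapositively, to find a prime in \<open>{x<..2 * n}\<close>.\<close>

lemma prime_gap_bound:
  fixes n x :: nat
  assumes n: "n \<ge> 1" and no: "\<And>p. prime p \<Longrightarrow> p \<le> 2 * n \<Longrightarrow> p \<le> x"
  shows "4 ^ n \<le> 2 * (2 * n) ^ x"
proof -
  define e where "e p = (GREATEST e. p ^ e \<le> 2 * n)" for p :: nat
  define Q where "Q = {p. prime p \<and> p \<le> 2 * n}"
  define M where "M = (\<Prod>p\<in>Q. p ^ e p)"
  have fQ: "finite Q" unfolding Q_def by simp
  have ebound: "j \<le> 2 * n" if "p \<in> Q" "p ^ j \<le> 2 * n" for p j
  proof -
    have "j < 2 ^ j" by simp
    also have "\<dots> \<le> p ^ j" using that prime_ge_2_nat[of p] unfolding Q_def by (intro power_mono) auto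
    finally show ?thesis using that by simp
  qed
  have e1: "p ^ e p \<le> 2 * n" if "p \<in> Q" for p
    unfolding e_def
    by (rule GreatestI_nat[where k = 0 and b = "2 * n"]) (use n ebound[OF that] in auto)
  have e2: "j \<le> e p" if "p \<in> Q" "p ^ j \<le> 2 * n" for p j
    unfolding e_def
    by (rule Greatest_le_nat[where b = "2 * n"]) (use that ebound in auto)
  have Mpos: "M > 0" unfolding M_def by (intro prod_pos) (auto simp: Q_def prime_gt_0_nat)
  have dvdM: "i dvd M" if i: "1 \<le> i" "i \<le> 2 * n" for i
  proof (rule multiplicity_le_imp_dvd)
    show "i \<noteq> 0" using i by simp
    fix p :: nat assume p: "prime p"
    show "multiplicity p i \<le> multiplicity p M"
    proof (cases "p dvd i")
      case True
      have "p \<in> Q" using True i p dvd_imp_le[of p i] unfolding Q_def by auto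
      have "p ^ multiplicity p i dvd i" by (rule multiplicity_dvd)
      then have "p ^ multiplicity p i \<le> i" by (rule dvd_imp_le) (use i in simp)
      then have "p ^ multiplicity p i \<le> 2 * n" using i by linarith
      then have "multiplicity p i \<le> e p" using e2 \<open>p \<in> Q\<close> by blast
      then have "p ^ multiplicity p i dvd p ^ e p" by (rule le_imp_power_dvd)
      also have "p ^ e p dvd M" unfolding M_def using fQ \<open>p \<in> Q\<close> by (rule dvd_prodI)
      finally show ?thesis using Mpos p by (intro multiplicity_geI) auto
    next
      case False
      then show ?thesis by (simp add: not_dvd_imp_multiplicity_0)
    qed
  qed
  have "n * ((2 * n) choose n) dvd M"
    using dvdM n by (intro mult_binomial_dvd_common_multiple) auto
  then have "n * ((2 * n) choose n) \<le> M" using Mpos by (rule dvd_imp_le)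
  also have "M \<le> (\<Prod>p\<in>Q. 2 * n)" unfolding M_def using e1 by (intro prod_mono) auto
  also have "\<dots> = (2 * n) ^ card Q" by simp
  also have "\<dots> \<le> (2 * n) ^ x"
  proof (rule power_increasing)
    have "Q \<subseteq> {1..x}" using no prime_ge_1_nat unfolding Q_def by auto
    then have "card Q \<le> card {1..x}" by (intro card_mono) auto
    then show "card Q \<le> x" by simp
  qed (use n in simp)
  finally have le: "n * ((2 * n) choose n) \<le> (2 * n) ^ x" .
  have "(4::real) ^ n / (2 * real n) \<le> real ((2 * n) choose n)"
    using n by (intro central_binomial_lower_bound) simp
  then have "(4::real) ^ n \<le> 2 * real (n * ((2 * n) choose n))"
    using n by (simp add: field_simps)
  also have "\<dots> \<le> 2 * real ((2 * n) ^ x)" using le by (simp only: of_nat_le_iff mult_le_cancel_left_pos zero_less_numeral)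
  finally have "real (4 ^ n) \<le> real (2 * (2 * n) ^ x)" by simp
  then show ?thesis by (simp only: of_nat_le_iff)
qed

text \<open>The loss of an arbitrarily small power is harmless, because the final bound loses one anyway.\<close>

lemma exists_prime_between:
  fixes \<eta> :: real
  assumes \<eta>: "\<eta> > 0"
  shows "\<exists>C\<ge>1. \<forall>x\<ge>1. \<exists>p::nat. prime p \<and> x \<le> real p \<and> real p \<le> C * x powr (1 + \<eta>)"
proof -
  \<comment> \<open>The logarithm is bounded by a \<open>\<theta>\<close>-th power, so a prime gap
    would force \<open>n powr (1 - \<theta>)\<close> below a constant times \<open>x\<close>. Since
    \<open>(1 - \<theta>) * (1 + \<eta>) = 1\<close>, a number \<open>n\<close> of order
    \<open>x powr (1 + \<eta>)\<close> is already too large for that.\<close>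
  define \<theta> where "\<theta> = \<eta> / (1 + \<eta>)"
  have \<theta>: "0 < \<theta>" "\<theta> < 1" "(1 - \<theta>) * (1 + \<eta>) = 1" unfolding \<theta>_def using \<eta> by (auto simp: field_simps)
  define K where "K = 4 / (\<theta> * ln 2) + 1"
  have K: "K > 1" "4 / (\<theta> * ln 2) < K" unfolding K_def using \<theta> by auto
  \<comment> \<open>The prime is at most \<open>2 * n\<close>, and \<open>n\<close> exceeds
    \<open>z\<close> by at most 2; this accounts for the 2 and the 4.\<close>
  define C where "C = 2 * K powr (1 + \<eta>) + 4"
  have "\<exists>p::nat. prime p \<and> x \<le> real p \<and> real p \<le> C * x powr (1 + \<eta>)" if x: "x \<ge> 1" for x :: real
  proof -
    define z where "z = (K * x) powr (1 + \<eta>)"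
    define n where "n = nat \<lceil>z\<rceil> + 1"
    have xp: "x powr (1 + \<eta>) \<ge> 1" using x \<eta> by (intro ge_one_powr_ge_zero) auto
    have z0: "z \<ge> 0" unfolding z_def by simp
    have nz: "z \<le> real n" "real n \<le> z + 2" unfolding n_def using z0 by linarith+
    have "2 * real n \<le> 2 * z + 4" using nz by simp
    also have "\<dots> \<le> C * x powr (1 + \<eta>)"
      unfolding z_def C_def using x K xp by (simp add: powr_mult algebra_simps)
    finally have up: "2 * real n \<le> C * x powr (1 + \<eta>)" .
    have "\<exists>p. prime p \<and> p \<le> 2 * n \<and> \<not> p \<le> nat \<lfloor>x\<rfloor>"
    proof (rule ccontr)
      assume "\<not> ?thesis"
      then have "4 ^ n \<le> 2 * (2 * n) ^ nat \<lfloor>x\<rfloor>"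
        by (intro prime_gap_bound) (auto simp: n_def)
      then have "real (4 ^ n) \<le> real (2 * (2 * n) ^ nat \<lfloor>x\<rfloor>)" by (simp only: of_nat_le_iff)
      then have le: "(4::real) ^ n \<le> 2 * (2 * real n) ^ nat \<lfloor>x\<rfloor>" by simp
      have n1: "n \<ge> 1" unfolding n_def by simp
      have "real n * ln 4 = ln ((4::real) ^ n)" by (simp add: ln_realpow)
      also have "\<dots> \<le> ln (2 * (2 * real n) ^ nat \<lfloor>x\<rfloor>)" using le n1 by (subst ln_le_cancel_iff) auto
      also have "\<dots> = ln 2 + real (nat \<lfloor>x\<rfloor>) * ln (2 * real n)"
        using n1 by (simp add: ln_mult ln_realpow algebra_simps)
      also have "\<dots> \<le> ln 2 + x * ln (2 * real n)"
        using n1 x by (intro add_left_mono mult_right_mono) auto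
      finally have "real n * ln 4 \<le> ln 2 + x * ln (2 * real n)" .
      moreover have "real n * ln 4 = 2 * (real n * ln 2)" using ln_realpow[of 2 2] by simp
      moreover have "ln 2 \<le> real n * ln 2" using n1 by simp
      ultimately have "real n * ln 2 \<le> x * ln (2 * real n)" by linarith
      also have "ln (2 * real n) \<le> (2 * real n) powr \<theta> / \<theta>"
        using \<theta> n1 by (intro ln_powr_bound) auto
      finally have "real n * ln 2 \<le> x * ((2 * real n) powr \<theta> / \<theta>)" using x by simp
      moreover have "(2 * real n) powr \<theta> \<le> 2 * real n powr \<theta>"
      proof -
        have "(2::real) powr \<theta> \<le> 2 powr 1" using \<theta> by (intro powr_mono) auto
        then show ?thesis by (simp add: powr_mult mult_right_mono)
      qed
      then have "x * ((2 * real n) powr \<theta> / \<theta>) \<le> x * (2 * real n powr \<theta> / \<theta>)"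
        using x \<theta> by (intro mult_left_mono divide_right_mono) auto
      ultimately have "real n * ln 2 \<le> x * (2 * real n powr \<theta> / \<theta>)" by linarith
      then have "real n \<le> (2 / (\<theta> * ln 2) * x) * real n powr \<theta>"
        using \<theta> by (simp add: field_simps)
      moreover have "real n = real n powr (1 - \<theta>) * real n powr \<theta>"
        using n1 by (simp flip: powr_add)
      ultimately have "real n powr (1 - \<theta>) * real n powr \<theta> \<le> (2 / (\<theta> * ln 2) * x) * real n powr \<theta>"
        by simp
      then have "real n powr (1 - \<theta>) \<le> 2 / (\<theta> * ln 2) * x"
        by (rule mult_right_le_imp_le) (use n1 in simp)
      also have "\<dots> < K * x"
      proof -
        have "2 / (\<theta> * ln 2) \<le> 4 / (\<theta> * ln 2)" using \<theta> by (intro divide_right_mono) auto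
        then show ?thesis using K x by (intro mult_strict_right_mono) auto
      qed
      also have "K * x = z powr (1 - \<theta>)"
        unfolding z_def using K x \<theta> by (simp add: powr_powr mult.commute)
      also have "\<dots> \<le> real n powr (1 - \<theta>)" using nz z0 \<theta> by (intro powr_mono2) auto
      finally show False by simp
    qed
    then obtain p where p: "prime p" "p \<le> 2 * n" "\<not> p \<le> nat \<lfloor>x\<rfloor>" by blast
    have "x \<le> real p" using p(3) x by linarith
    moreover have "real p \<le> 2 * real n" using p(2) by (metis of_nat_le_iff of_nat_mult of_nat_numeral)
    ultimately show ?thesis using p(1) up by (intro exI[of _ p]) auto
  qed
  moreover have "C \<ge> 1" unfolding C_def by simp
  ultimately show ?thesis by blast
qed

section \<open>Evading flats modulo a prime\<close>

text \<open>The directions \<open>b\<close> may be dependent, so flats of lower dimension are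
  included and every flat is coded by \<open>k + 1\<close> vectors. The index set \<open>I\<close>
  is a parameter because the normals use a chart that omits one coordinate.\<close>

definition flat_mod :: "nat \<Rightarrow> 'i set \<Rightarrow> nat \<Rightarrow> ('i \<Rightarrow> int) \<Rightarrow> (nat \<Rightarrow> 'i \<Rightarrow> int) \<Rightarrow> ('i \<Rightarrow> int) set" where
  "flat_mod p I k a b =
     {s. \<exists>t::nat \<Rightarrow> int. \<forall>l\<in>I. [s l = a l + (\<Sum>i<k. t i * b i l)] (mod int p)}"

definition evasive_mod :: "nat \<Rightarrow> 'i set \<Rightarrow> nat \<Rightarrow> nat \<Rightarrow> ('i \<Rightarrow> int) set \<Rightarrow> bool" where
  "evasive_mod p I k r S \<longleftrightarrow> (\<forall>a b. card (S \<inter> flat_mod p I k a b) < r)"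

text \<open>Extensionality off \<open>I\<close> makes the cube finite and lets the residues on
  \<open>I\<close> determine its elements.\<close>

definition cube :: "nat \<Rightarrow> 'i set \<Rightarrow> ('i \<Rightarrow> int) set" where
  "cube p I = I \<rightarrow>\<^sub>E {0..<int p}"

lemma finite_cube: "finite I \<Longrightarrow> finite (cube p I)"
  unfolding cube_def by (intro finite_PiE) auto

lemma card_cube: "finite I \<Longrightarrow> card (cube p I) = p ^ card I"
  unfolding cube_def by (simp add: card_PiE)

lemma mod_in_cube: "p > 0 \<Longrightarrow> (\<lambda>l\<in>I. f l mod int p) \<in> cube p I"
  unfolding cube_def by auto

lemma cube_mod_eq: "s \<in> cube p I \<Longrightarrow> l \<in> I \<Longrightarrow> s l mod int p = s l"
  unfolding cube_def by (auto dest!: PiE_mem)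

lemma card_flat_mod_le:
  assumes I: "finite I" and p: "p > 0"
  shows "card (cube p I \<inter> flat_mod p I k a b) \<le> p ^ k"
proof -
  let ?T = "{..<k} \<rightarrow>\<^sub>E {0..<int p}"
  define g where "g t = (\<lambda>l\<in>I. (a l + (\<Sum>i<k. t i * b i l)) mod int p)" for t :: "nat \<Rightarrow> int"
  have "cube p I \<inter> flat_mod p I k a b \<subseteq> g ` ?T"
  proof
    fix s assume s: "s \<in> cube p I \<inter> flat_mod p I k a b"
    then obtain t where t: "\<And>l. l \<in> I \<Longrightarrow> [s l = a l + (\<Sum>i<k. t i * b i l)] (mod int p)"
      unfolding flat_mod_def by blast
    define t' where "t' = (\<lambda>i\<in>{..<k}. t i mod int p)"
    have "s = g t'"
    proof
      fix l
      show "s l = g t' l"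
      proof (cases "l \<in> I")
        case True
        have "[(\<Sum>i<k. t i * b i l) = (\<Sum>i<k. t' i * b i l)] (mod int p)"
          unfolding t'_def by (intro cong_sum) (simp add: cong_def mod_mult_left_eq)
        then have "[s l = a l + (\<Sum>i<k. t' i * b i l)] (mod int p)"
          using t[OF True] by (meson cong_add_lcancel cong_trans)
        then show ?thesis using True cube_mod_eq[of s p I l] s unfolding g_def cong_def by auto
      next
        case False
        then show ?thesis using s unfolding g_def cube_def by (auto dest!: PiE_arb)
      qed
    qed
    moreover have "t' \<in> ?T" unfolding t'_def using p by auto
    ultimately show "s \<in> g ` ?T" by blast
  qed
  then have "card (cube p I \<inter> flat_mod p I k a b) \<le> card ?T"
    by (intro surj_card_le) (auto intro!: finite_PiE)
  then show ?thesis by (simp add: card_PiE)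
qed

lemma flat_mod_reduce:
  "flat_mod p I k a b = flat_mod p I k (\<lambda>l\<in>I. a l mod int p)
     (\<lambda>i\<in>{..<k}. \<lambda>l\<in>I. b i l mod int p)"
proof -
  have "[a l + (\<Sum>i<k. t i * b i l) =
      a l mod int p + (\<Sum>i<k. t i * (b i l mod int p))] (mod int p)" for l and t :: "nat \<Rightarrow> int"
    by (intro cong_add cong_sum) (simp_all add: cong_def mod_mult_right_eq)
  then have "[s l = a l + (\<Sum>i<k. t i * b i l)] (mod int p) \<longleftrightarrow>
      [s l = a l mod int p + (\<Sum>i<k. t i * (b i l mod int p))] (mod int p)"
    for s :: "'a \<Rightarrow> int" and l and t :: "nat \<Rightarrow> int"
    unfolding cong_def by presburger
  then have "(\<forall>l\<in>I. [s l = a l + (\<Sum>i<k. t i * b i l)] (mod int p)) \<longleftrightarrow>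
      (\<forall>l\<in>I. [s l = (\<lambda>l\<in>I. a l mod int p) l +
        (\<Sum>i<k. t i * (\<lambda>i\<in>{..<k}. \<lambda>l\<in>I. b i l mod int p) i l)] (mod int p))"
    for s :: "'a \<Rightarrow> int" and t :: "nat \<Rightarrow> int"
    by simp
  then show ?thesis unfolding flat_mod_def by presburger
qed

text \<open>Only the residues of the base point and of the \<open>k\<close> directions matter, which
  leaves \<open>k + 1\<close> elements of the cube to choose.\<close>

lemma finite_card_flats:
  fixes I :: "'i set" and k :: nat
  assumes I: "finite I" and p: "p > 0"
  defines "\<F> \<equiv> {cube p I \<inter> flat_mod p I k a b | a b. True}"
  shows "finite \<F>" "card \<F> \<le> p ^ (card I * (k + 1))"
proof -
  let ?P = "cube p I \<times> ({..<k} \<rightarrow>\<^sub>E cube p I)"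
  have sub: "\<F> \<subseteq> (\<lambda>(a, b). cube p I \<inter> flat_mod p I k a b) ` ?P"
  proof
    fix F assume "F \<in> \<F>"
    then obtain a b where "F = cube p I \<inter> flat_mod p I k a b" unfolding \<F>_def by blast
    then have "F = (\<lambda>(a, b). cube p I \<inter> flat_mod p I k a b)
        (\<lambda>l\<in>I. a l mod int p, \<lambda>i\<in>{..<k}. \<lambda>l\<in>I. b i l mod int p)"
      by (subst (asm) flat_mod_reduce) simp
    moreover have "(\<lambda>l\<in>I. a l mod int p, \<lambda>i\<in>{..<k}. \<lambda>l\<in>I. b i l mod int p) \<in> ?P"
      using mod_in_cube[OF p, of _ I] by auto
    ultimately show "F \<in> (\<lambda>(a, b). cube p I \<inter> flat_mod p I k a b) ` ?P" by (rule image_eqI)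
  qed
  have fP: "finite ?P" using finite_cube[OF I] by (auto intro!: finite_PiE)
  show "finite \<F>" using sub fP by (rule finite_surj[rotated])
  have "card \<F> \<le> card ?P" using fP sub by (rule surj_card_le)
  also have "\<dots> = p ^ (card I * (k + 1))"
    using I finite_cube[OF I] by (simp add: card_cartesian_product card_PiE card_cube power_mult[symmetric] power_add)
  finally show "card \<F> \<le> p ^ (card I * (k + 1))" .
qed

text \<open>Sampling at density \<open>1 / q\<close> with \<open>q\<close> about
  \<open>p powr (k + \<delta>)\<close> leaves fewer than one expected point per
  \<open>k\<close>-flat. The bound \<open>r\<close> is uniform in \<open>p\<close>, because both the
  number of flats and the gain from \<open>r\<close> are powers of \<open>p\<close>. The factor 4
  combines the 2 of the sampling lemma with the rounding of \<open>q\<close>.\<close>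

lemma exists_evasive_mod:
  fixes \<delta> :: real and k D :: nat
  assumes \<delta>: "\<delta> > 0"
  shows "\<exists>r. \<forall>p\<ge>2. \<forall>I::'i set. finite I \<longrightarrow> card I = D \<longrightarrow>
    (\<exists>S\<subseteq>cube p I. real p powr (real D - real k - \<delta>) \<le> 4 * real (card S) \<and> evasive_mod p I k r S)"
proof -
  \<comment> \<open>Comparing exponents of \<open>p\<close> in \<open>small\<close> requires
    \<open>1 + D * (k + 1) + k * r \<le> D + (k + \<delta>) * (r - 1)\<close>, which is this bound
    rearranged; the summand 1 absorbs the factor 2, as \<open>p \<ge> 2\<close>.\<close>
  define r where "r = nat \<lceil>(1 + real D * real k + real k) / \<delta>\<rceil> + 2"
  have r0: "r > 0" unfolding r_def by simp
  have "(1 + real D * real k + real k) / \<delta> \<le> real r - 1" unfolding r_def using \<delta> by linarith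
  then have r: "1 + real D * real k + real k \<le> \<delta> * (real r - 1)" using \<delta> by (simp add: field_simps)
  show ?thesis
  proof (intro exI[of _ r] allI impI)
    fix p :: nat and I :: "'i set"
    assume p: "p \<ge> 2" and I: "finite I" and D: "card I = D"
    define q where "q = nat \<lceil>real p powr (real k + \<delta>)\<rceil>"
    define \<F> where "\<F> = {cube p I \<inter> flat_mod p I k a b | a b. True}"
    have pk1: "real p powr (real k + \<delta>) \<ge> 1" using p \<delta> by (intro ge_one_powr_ge_zero) auto
    have q: "real p powr (real k + \<delta>) \<le> real q" "real q \<le> 2 * real p powr (real k + \<delta>)" "q > 0"
      unfolding q_def using pk1 by linarith+
    have cF: "card \<F> \<le> p ^ (D * (k + 1))" "finite \<F>"
      unfolding \<F>_def using finite_card_flats[OF I, of p k] p D by auto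
    have A: "F \<subseteq> cube p I \<and> card F \<le> p ^ k" if "F \<in> \<F>" for F
      using that card_flat_mod_le[OF I, of p k] p unfolding \<F>_def by auto
    have "real (2 * card \<F> * (p ^ k) ^ r) \<le> real p * real p ^ (D * (k + 1)) * real p ^ (k * r)"
      using cF(1) p by (simp add: power_mult mult_mono' del: of_nat_power flip: of_nat_power of_nat_mult)
    also have "\<dots> = real p powr (1 + real D * (real k + 1) + real k * real r)"
      using p by (simp add: powr_add powr_realpow[symmetric] algebra_simps)
    also have "\<dots> \<le> real p powr (real D + (real k + \<delta>) * (real r - 1))"
      using p r by (intro powr_mono) (auto simp: algebra_simps)
    also have "\<dots> = real p ^ D * (real p powr (real k + \<delta>)) ^ (r - 1)"
    proof -
      have "(real p powr (real k + \<delta>)) ^ (r - 1) = (real p powr (real k + \<delta>)) powr (real r - 1)"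
        using p r0 by (simp add: powr_realpow[symmetric] of_nat_diff del: powr_powr)
      also have "\<dots> = real p powr ((real k + \<delta>) * (real r - 1))" by (rule powr_powr)
      finally show ?thesis using p by (simp add: powr_add powr_realpow)
    qed
    also have "\<dots> \<le> real p ^ D * real q ^ (r - 1)"
      using q by (intro mult_left_mono power_mono) auto
    also have "\<dots> = real (card (cube p I) * q ^ (r - 1))"
      using card_cube[OF I] D by simp
    finally have small: "2 * card \<F> * (p ^ k) ^ r \<le> card (cube p I) * q ^ (r - 1)"
      by (simp only: of_nat_le_iff)
    obtain S where S: "S \<subseteq> cube p I" "card (cube p I) \<le> 2 * q * card S"
        "\<forall>F\<in>\<F>. card (F \<inter> S) < r"
      using exists_evasive_subset[OF finite_cube[OF I] q(3) r0 cF(2) A small] by metis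
    have "evasive_mod p I k r S"
      unfolding evasive_mod_def
    proof (intro allI)
      fix a b
      have "S \<inter> flat_mod p I k a b = (cube p I \<inter> flat_mod p I k a b) \<inter> S" using S(1) by blast
      then show "card (S \<inter> flat_mod p I k a b) < r" using S(3) unfolding \<F>_def by auto
    qed
    moreover have "real p powr (real D - real k - \<delta>) \<le> 4 * real (card S)"
    proof -
      have "real (p ^ D) \<le> real (2 * q * card S)" using S(2) card_cube[OF I, of p] D by (simp only: of_nat_le_iff)
      also have "\<dots> \<le> 2 * (2 * real p powr (real k + \<delta>)) * real (card S)"
        using q(2) by (simp add: mult_right_mono)
      finally have "real p powr real D \<le> 4 * real (card S) * real p powr (real k + \<delta>)"
        using p by (simp add: powr_realpow mult_ac)
      then have "real p powr real D / real p powr (real k + \<delta>) \<le> 4 * real (card S)"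
        using p by (simp add: divide_le_eq)
      then show ?thesis by (simp flip: powr_diff add: diff_diff_eq)
    qed
    ultimately show "\<exists>S\<subseteq>cube p I. real p powr (real D - real k - \<delta>) \<le> 4 * real (card S) \<and> evasive_mod p I k r S"
      using S(1) by blast
  qed
qed

section \<open>Independence modulo a prime and over the reals\<close>

text \<open>Coefficients are integers rather than residues, so that an integer relation can be
  divided by \<open>p\<close> repeatedly. The family is indexed: for \<open>p > 1\<close>, equal
  vectors at distinct indices are dependent.\<close>

definition indep_mod :: "nat \<Rightarrow> 'i set \<Rightarrow> ('b \<Rightarrow> 'i \<Rightarrow> int) \<Rightarrow> 'b set \<Rightarrow> bool" where
  "indep_mod p I v B \<longleftrightarrow>
     (\<forall>c. (\<forall>l\<in>I. int p dvd (\<Sum>b\<in>B. c b * v b l)) \<longrightarrow> (\<forall>b\<in>B. int p dvd c b))"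

text \<open>A maximal independent subset spans: adjoining \<open>s\<close> creates a relation whose
  coefficient at \<open>s\<close> is not divisible by the prime \<open>p\<close>, hence invertible,
  and the relation can be solved for \<open>v s\<close>.\<close>

lemma exists_basis_mod:
  fixes v :: "'b \<Rightarrow> 'i \<Rightarrow> int"
  assumes p: "prime p" and T: "finite T"
  shows "\<exists>B\<subseteq>T. indep_mod p I v B \<and>
    (\<forall>s\<in>T. \<exists>t. \<forall>l\<in>I. [v s l = (\<Sum>b\<in>B. t b * v b l)] (mod int p))"
proof -
  define \<B> where "\<B> = {B. B \<subseteq> T \<and> indep_mod p I v B}"
  have "finite \<B>" unfolding \<B>_def using T by simp
  moreover have "{} \<in> \<B>" unfolding \<B>_def indep_mod_def by simp
  ultimately obtain B where B: "B \<in> \<B>" "\<forall>B'\<in>\<B>. B \<subseteq> B' \<longrightarrow> B = B'"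
    using finite_has_maximal2[of \<B> "{}"] by blast
  have BT: "B \<subseteq> T" and ind: "indep_mod p I v B" using B(1) unfolding \<B>_def by auto
  have fB: "finite B" using BT T finite_subset by blast
  have "\<exists>t. \<forall>l\<in>I. [v s l = (\<Sum>b\<in>B. t b * v b l)] (mod int p)" if s: "s \<in> T" for s
  proof (cases "s \<in> B")
    case True
    have "(\<Sum>b\<in>B. (if b = s then 1 else 0) * v b l) = v s l" for l
    proof -
      have "(\<Sum>b\<in>B. (if b = s then 1 else 0) * v b l) = (\<Sum>b\<in>B. if b = s then v b l else 0)"
        by (intro sum.cong) auto
      then show ?thesis using fB True by simp
    qed
    then show ?thesis by (intro exI[of _ "\<lambda>b. if b = s then 1 else 0"]) simp
  next
    case False
    then have "insert s B \<notin> \<B>" using B(2) by blast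
    then have "\<not> indep_mod p I v (insert s B)" using s BT unfolding \<B>_def by simp
    then obtain c where c: "\<forall>l\<in>I. int p dvd (\<Sum>b\<in>insert s B. c b * v b l)"
        and nz: "\<exists>b\<in>insert s B. \<not> int p dvd c b"
      unfolding indep_mod_def by blast
    have c': "int p dvd c s * v s l + (\<Sum>b\<in>B. c b * v b l)" if "l \<in> I" for l
      using c that fB False by simp
    have "\<not> int p dvd c s"
    proof
      assume d: "int p dvd c s"
      have "int p dvd (\<Sum>b\<in>B. c b * v b l)" if "l \<in> I" for l
        using c'[OF that] d by (meson dvd_add_right_iff dvd_mult2)
      then have "\<forall>b\<in>B. int p dvd c b" using ind unfolding indep_mod_def by blast
      then show False using d nz by blast
    qed
    then have "coprime (c s) (int p)"
      using p by (meson coprime_commute prime_imp_coprime prime_nat_int_transfer)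
    then obtain e where e: "[c s * e = 1] (mod int p)" using cong_solve_coprime_int by blast
    have "[v s l = (\<Sum>b\<in>B. (- e * c b) * v b l)] (mod int p)" if l: "l \<in> I" for l
    proof -
      have "int p dvd c s * e - 1" using e by (simp add: cong_iff_dvd_diff)
      then have "int p dvd (c s * e - 1) * v s l" by (rule dvd_mult2)
      moreover have "int p dvd e * (c s * v s l + (\<Sum>b\<in>B. c b * v b l))" using c'[OF l] by simp
      ultimately have "int p dvd e * (c s * v s l + (\<Sum>b\<in>B. c b * v b l)) - (c s * e - 1) * v s l"
        by (simp add: dvd_diff)
      also have "\<dots> = v s l - (\<Sum>b\<in>B. (- e * c b) * v b l)"
        by (simp add: algebra_simps sum_distrib_left sum_negf)
      finally show ?thesis by (simp add: cong_iff_dvd_diff)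
    qed
    then show ?thesis by (intro exI[of _ "\<lambda>b. - e * c b"]) blast
  qed
  then show ?thesis using BT ind by blast
qed

text \<open>If a basis of the differences from \<open>a\<close> had at most \<open>k\<close>
  elements, all of \<open>T\<close> would lie on one \<open>k\<close>-flat through \<open>a\<close>,
  against evasion.\<close>

lemma evasive_mod_indep:
  fixes S :: "('i \<Rightarrow> int) set"
  assumes p: "prime p" and S: "finite S" and ev: "evasive_mod p I k r S"
    and T: "T \<subseteq> S" "r \<le> card T"
  shows "\<exists>B\<subseteq>T. k < card B \<and> indep_mod p I (\<lambda>b l. b l - a l) B"
proof -
  let ?v = "\<lambda>(b::'i \<Rightarrow> int) l. b l - a l"
  have fT: "finite T" using T(1) S by (rule finite_subset)
  obtain B where B: "B \<subseteq> T" "indep_mod p I ?v B"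
      and sp: "\<forall>s\<in>T. \<exists>t. \<forall>l\<in>I. [?v s l = (\<Sum>b\<in>B. t b * ?v b l)] (mod int p)"
    using exists_basis_mod[OF p fT, of I ?v] by (elim exE conjE)
  have fB: "finite B" using B(1) fT by (rule finite_subset)
  have "k < card B"
  proof (rule ccontr)
    assume "\<not> k < card B"
    then have le: "card B \<le> k" by simp
    obtain h where h: "bij_betw h {..<card B} B"
      using fB by (metis bij_betw_from_nat_into_finite)
    \<comment> \<open>\<open>flat_mod\<close> expects exactly \<open>k\<close> directions, so a
      shorter basis is padded with zeros.\<close>
    define b where "b i l = (if i < card B then h i l - a l else 0)" for i l
    have "T \<subseteq> S \<inter> flat_mod p I k a b"
    proof
      fix s assume s: "s \<in> T"
      then obtain t where t: "\<forall>l\<in>I. [?v s l = (\<Sum>b\<in>B. t b * ?v b l)] (mod int p)" using sp by blast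
      have "[s l = a l + (\<Sum>i<k. t (h i) * b i l)] (mod int p)" if l: "l \<in> I" for l
      proof -
        have "(\<Sum>b\<in>B. t b * ?v b l) = (\<Sum>i<card B. t (h i) * ?v (h i) l)"
          using sum.reindex_bij_betw[OF h, of "\<lambda>b. t b * ?v b l"] by simp
        also have "\<dots> = (\<Sum>i<card B. t (h i) * b i l)" unfolding b_def by (intro sum.cong) auto
        also have "\<dots> = (\<Sum>i<k. t (h i) * b i l)"
          using le by (intro sum.mono_neutral_left) (auto simp: b_def)
        finally have e: "(\<Sum>b\<in>B. t b * ?v b l) = (\<Sum>i<k. t (h i) * b i l)" .
        have "[s l - a l = (\<Sum>i<k. t (h i) * b i l)] (mod int p)"
          using bspec[OF t l] unfolding e .
        then have "[a l + (s l - a l) = a l + (\<Sum>i<k. t (h i) * b i l)] (mod int p)"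
          by (rule cong_add[OF cong_refl])
        then show ?thesis by simp
      qed
      then have "s \<in> flat_mod p I k a b" unfolding flat_mod_def by (intro CollectI exI[of _ "t \<circ> h"]) simp
      then show "s \<in> S \<inter> flat_mod p I k a b" using s T by blast
    qed
    then have "card T \<le> card (S \<inter> flat_mod p I k a b)" using S by (intro card_mono) auto
    also have "\<dots> < r" using ev unfolding evasive_mod_def by blast
    finally show False using T by simp
  qed
  then show ?thesis using B by blast
qed

text \<open>Descent: independence modulo \<open>p\<close> makes every coefficient divisible by
  \<open>p\<close>, and the quotients again form a relation, so every power of \<open>p\<close>
  divides each coefficient.\<close>

lemma indep_mod_imp_int:
  assumes p: "p > 1" and ind: "indep_mod p UNIV v B"
    and c: "\<And>l. (\<Sum>b\<in>B. c b * v b l) = 0" and b: "b \<in> B"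
  shows "c b = 0"
proof -
  have "\<forall>b\<in>B. int p ^ j dvd c b" for j
  proof (induction j)
    case (Suc j)
    define c' where "c' b = c b div int p ^ j" for b
    have c': "c b = int p ^ j * c' b" if "b \<in> B" for b
      using Suc.IH that unfolding c'_def by simp
    have "(\<Sum>b\<in>B. c' b * v b l) = 0" for l
    proof -
      have "int p ^ j * (\<Sum>b\<in>B. c' b * v b l) = (\<Sum>b\<in>B. c b * v b l)"
        unfolding sum_distrib_left by (intro sum.cong) (auto simp: c')
      then show ?thesis using c[of l] p by simp
    qed
    then have "\<forall>b\<in>B. int p dvd c' b" using ind unfolding indep_mod_def by simp
    then show ?case using c' by (metis mult.commute mult_dvd_mono power_Suc dvd_refl)
  qed simp
  then have d: "int p ^ j dvd c b" for j using b by blast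
  show ?thesis
  proof (rule ccontr)
    assume nz: "c b \<noteq> 0"
    define j where "j = nat \<bar>c b\<bar>"
    have "int p ^ j \<le> \<bar>c b\<bar>" using d[of j] nz by (metis dvd_abs_iff dvd_imp_le_int abs_ge_self order_trans)
    moreover have "j < 2 ^ j" by simp
    then have "int j < 2 ^ j" by (metis of_nat_less_numeral_power_cancel_iff)
    moreover have "(2::int) ^ j \<le> int p ^ j" using p by (intro power_mono) auto
    ultimately show False unfolding j_def by linarith
  qed
qed

text \<open>A real relation among integer vectors is turned into an integer one by simultaneous
  Dirichlet approximation of its coefficients.\<close>

lemma indep_mod_imp_real:
  fixes v :: "'b \<Rightarrow> 'i::finite \<Rightarrow> int" and c :: "'b \<Rightarrow> real"
  assumes p: "p > 1" and fB: "finite B" and ind: "indep_mod p UNIV v B"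
    and c: "\<And>l. (\<Sum>b\<in>B. c b * real_of_int (v b l)) = 0" and b: "b \<in> B"
  shows "c b = 0"
proof (rule ccontr)
  assume nz: "c b \<noteq> 0"
  define V where "V = (\<Sum>l\<in>UNIV. \<Sum>b\<in>B. \<bar>v b l\<bar>)"
  \<comment> \<open>With precision \<open>1 / N\<close>, each coordinate of the rounded relation is
    at most \<open>V / N < 1\<close> in absolute value; being an integer, it is 0.\<close>
  define N where "N = nat V + 1"
  have V0: "V \<ge> 0" unfolding V_def by (intro sum_nonneg) auto
  have N: "N > 0" "real_of_int V < real N" unfolding N_def using V0 by auto
  obtain h where h: "bij_betw h {..<card B} B"
    using fB by (metis bij_betw_from_nat_into_finite)
  define g where "g = inv_into {..<card B} h"
  have g: "g b < card B" "h (g b) = b" if "b \<in> B" for b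
    using h that unfolding g_def bij_betw_def
    by (metis inv_into_into lessThan_iff, metis f_inv_into_f)
  \<comment> \<open>Division by \<open>c b\<close> makes the coefficient at \<open>b\<close> equal
    to 1. If its numerator \<open>P (g b)\<close> were 0, then \<open>q\<close> itself would be
    below \<open>1 / N\<close>, which is the final contradiction.\<close>
  obtain q P where q: "0 < q"
    and P: "\<And>i. i < card B \<Longrightarrow> \<bar>of_int q * (c (h i) / c b) - of_int (P i)\<bar> < 1 / real N"
    using Dirichlet_approx_simult[OF N(1), of "card B" "\<lambda>i. c (h i) / c b"] by metis
  have P': "\<bar>of_int q * (c x / c b) - of_int (P (g x))\<bar> < 1 / real N" if "x \<in> B" for x
    using P[of "g x"] g[OF that] by simp
  have "(\<Sum>x\<in>B. P (g x) * v x l) = 0" for l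
  proof -
    have "(\<Sum>x\<in>B. of_int q * (c x / c b) * v x l) = of_int q / c b * (\<Sum>x\<in>B. c x * v x l)"
      unfolding sum_distrib_left by (intro sum.cong) auto
    then have z: "(\<Sum>x\<in>B. of_int q * (c x / c b) * v x l) = 0" using c[of l] by simp
    have "\<bar>\<Sum>x\<in>B. real_of_int (P (g x)) * v x l\<bar>
        = \<bar>\<Sum>x\<in>B. (of_int q * (c x / c b) - of_int (P (g x))) * v x l\<bar>"
      using z by (simp add: left_diff_distrib sum_subtractf)
    also have "\<dots> \<le> (\<Sum>x\<in>B. \<bar>(of_int q * (c x / c b) - of_int (P (g x))) * v x l\<bar>)"
      by (rule sum_abs)
    also have "\<dots> \<le> (\<Sum>x\<in>B. 1 / real N * \<bar>v x l\<bar>)"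
      unfolding abs_mult using P' by (intro sum_mono mult_mono) (auto intro: less_imp_le)
    also have "\<dots> = 1 / real N * (\<Sum>x\<in>B. \<bar>v x l\<bar>)" by (simp add: sum_distrib_left)
    also have "\<dots> \<le> 1 / real N * of_int V"
    proof -
      have "(\<Sum>x\<in>B. \<bar>v x l\<bar>) \<le> V"
        unfolding V_def by (rule member_le_sum) (auto intro: sum_nonneg)
      then show ?thesis by (intro mult_left_mono) (simp_all only: of_int_le_iff, simp)
    qed
    also have "\<dots> < 1" using N by simp
    finally have "\<bar>real_of_int (\<Sum>x\<in>B. P (g x) * v x l)\<bar> < 1" by simp
    then show ?thesis by linarith
  qed
  then have "P (g b) = 0" using indep_mod_imp_int[OF p ind, of "P \<circ> g"] b by simp
  then have "\<bar>real_of_int q\<bar> < 1 / real N" using P'[OF b] nz by simp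
  also have "\<dots> \<le> 1" using N by simp
  finally show False using q by simp
qed

definition real_vec :: "('n \<Rightarrow> int) \<Rightarrow> real ^ 'n" where
  "real_vec v = (\<chi> l. real_of_int (v l))"

text \<open>Equal vectors at two indices would give the relation with coefficients 1 and -1, so
  independence also yields injectivity and no element of \<open>B\<close> is lost in the
  image.\<close>

lemma indep_mod_imp_dim:
  fixes v :: "'b \<Rightarrow> 'n::finite \<Rightarrow> int"
  assumes p: "p > 1" and fB: "finite B" and ind: "indep_mod p UNIV v B"
  shows "card B \<le> dim ((real_vec \<circ> v) ` B)"
proof -
  let ?w = "real_vec \<circ> v"
  have zero: "\<forall>b\<in>B. c b = 0" if "(\<Sum>b\<in>B. c b *\<^sub>R ?w b) = 0" for c
  proof
    fix b assume b: "b \<in> B"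
    have "(\<Sum>b\<in>B. c b * real_of_int (v b l)) = 0" for l
    proof -
      have "(\<Sum>b\<in>B. c b *\<^sub>R ?w b) $ l = 0" using that by simp
      then show ?thesis by (simp add: real_vec_def)
    qed
    then show "c b = 0" using indep_mod_imp_real[OF p fB ind _ b] by blast
  qed
  have inj: "inj_on ?w B"
  proof (rule inj_onI, rule ccontr)
    fix x y assume xy: "x \<in> B" "y \<in> B" "?w x = ?w y" "x \<noteq> y"
    define c where "c b = (if b = x then 1 else 0) - (if b = y then 1 else 0::real)" for b
    have "(\<Sum>b\<in>B. c b *\<^sub>R ?w b)
        = (\<Sum>b\<in>B. if b = x then ?w b else 0) - (\<Sum>b\<in>B. if b = y then ?w b else 0)"
      unfolding sum_subtractf[symmetric] c_def by (intro sum.cong) auto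
    also have "\<dots> = 0" using xy fB by simp
    finally have "c x = 0" using zero xy by blast
    then show False using xy unfolding c_def by simp
  qed
  have "independent (?w ` B)"
    unfolding independent_explicit
  proof (intro conjI allI impI)
    show "finite (?w ` B)" using fB by simp
    fix c assume "(\<Sum>v\<in>?w ` B. c v *\<^sub>R v) = 0"
    moreover have "(\<Sum>v\<in>?w ` B. c v *\<^sub>R v) = (\<Sum>b\<in>B. c (?w b) *\<^sub>R ?w b)"
      by (subst sum.reindex[OF inj]) (simp add: o_def)
    ultimately have "(\<Sum>b\<in>B. c (?w b) *\<^sub>R ?w b) = 0" by simp
    then have "\<forall>b\<in>B. c (?w b) = 0" by (rule zero)
    then show "\<forall>v\<in>?w ` B. c v = 0" by blast
  qed
  then have "card (?w ` B) \<le> dim (?w ` B)" by (intro independent_card_le_dim) auto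
  then show ?thesis unfolding card_image[OF inj] .
qed

section \<open>Points and normals\<close>

lemma evasive_mod_subset:
  assumes "evasive_mod p I k r S" "S' \<subseteq> S" "finite S"
  shows "evasive_mod p I k r S'"
  unfolding evasive_mod_def
proof (intro allI)
  fix a b
  have "card (S' \<inter> flat_mod p I k a b) \<le> card (S \<inter> flat_mod p I k a b)"
    using assms(2,3) by (intro card_mono) auto
  also have "\<dots> < r" using assms(1) unfolding evasive_mod_def by blast
  finally show "card (S' \<inter> flat_mod p I k a b) < r" .
qed

text \<open>Inverts the size bound: \<open>n\<close> is prescribed and the modulus is fitted to it.
  Surplus points are discarded, which preserves evasion.\<close>

lemma exists_evasive_mod_card:
  fixes \<delta> :: real and k D :: nat
  assumes \<delta>: "\<delta> > 0" and kD: "k < D"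
  shows "\<exists>r C. C \<ge> 1 \<and> (\<forall>n\<ge>1. \<forall>I::'i set. finite I \<longrightarrow> card I = D \<longrightarrow>
    (\<exists>p S. prime p \<and> real p \<le> C * real n powr (1 / (real D - real k) + \<delta>) \<and>
      S \<subseteq> cube p I \<and> card S = n \<and> evasive_mod p I k r S))"
proof -
  define u where "u = real D - real k"
  have u: "u \<ge> 1" unfolding u_def using kD by simp
  \<comment> \<open>One factor \<open>1 + \<tau>\<close> pays for the density of the evasive set,
    the other for the prime; \<open>\<tau> \<le> 1\<close> keeps their product below
    \<open>1 + 3 * \<tau>\<close>.\<close>
  define \<tau> where "\<tau> = min 1 (\<delta> * u / 3)"
  have \<tau>: "0 < \<tau>" "\<tau> \<le> 1" "3 * \<tau> \<le> \<delta> * u" unfolding \<tau>_def using \<delta> u by auto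
  have "\<tau> * \<tau> \<le> \<tau> * 1" using \<tau> by (intro mult_left_mono) auto
  then have "(1 + \<tau>) * (1 + \<tau>) \<le> 1 + 3 * \<tau>" by (simp add: algebra_simps)
  also have "\<dots> \<le> 1 + \<delta> * u" using \<tau> by simp
  finally have "(1 + \<tau>) * (1 + \<tau>) / u \<le> (1 + \<delta> * u) / u" using u by (intro divide_right_mono) auto
  also have "(1 + \<delta> * u) / u = 1 / u + \<delta>" using u by (simp add: add_divide_distrib)
  finally have ex: "(1 + \<tau>) / u * (1 + \<tau>) \<le> 1 / u + \<delta>" by (simp only: times_divide_eq_left)
  define \<delta>' where "\<delta>' = u * \<tau> / (1 + \<tau>)"
  have "(1 + \<tau>) * (u - \<delta>') = u"
    unfolding \<delta>'_def using \<tau>(1) by (simp add: right_diff_distrib) (simp add: algebra_simps)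
  then have \<delta>': "\<delta>' > 0" "(1 + \<tau>) / u * (u - \<delta>') = 1"
    unfolding \<delta>'_def using u \<tau> by simp_all
  obtain r where r: "\<forall>p\<ge>2. \<forall>I::'i set. finite I \<longrightarrow> card I = D \<longrightarrow>
    (\<exists>S\<subseteq>cube p I. real p powr (real D - real k - \<delta>') \<le> 4 * real (card S) \<and> evasive_mod p I k r S)"
    using exists_evasive_mod[OF \<delta>'(1), of D k] by (elim exE)
  obtain C0 where C0: "C0 \<ge> 1"
      "\<forall>x\<ge>1. \<exists>p::nat. prime p \<and> x \<le> real p \<and> real p \<le> C0 * x powr (1 + \<tau>)"
    using exists_prime_between[OF \<tau>(1)] by (elim exE conjE)
  define C where "C = C0 * 4 powr (1 / u + \<delta>)"
  have "1 \<le> (4::real) powr (1 / u + \<delta>)" using u \<delta> by (intro ge_one_powr_ge_zero) auto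
  then have C: "C \<ge> 1" unfolding C_def using C0(1) mult_mono[of 1 C0 1 "4 powr (1 / u + \<delta>)"] by simp
  show ?thesis
  proof (rule exI[of _ r], rule exI[of _ C], intro conjI allI impI C)
    fix n :: nat and I :: "'i set"
    assume n: "n \<ge> 1" and I: "finite I" "card I = D"
    \<comment> \<open>By the choice of \<open>\<delta>'\<close>,
      \<open>x powr (u - \<delta>')\<close> is exactly \<open>4 * n\<close>, and the 4 cancels the
      constant in the size of \<open>S\<close>.\<close>
    define x where "x = (4 * real n) powr ((1 + \<tau>) / u)"
    have x1: "x \<ge> 1" unfolding x_def using n u \<tau> by (intro ge_one_powr_ge_zero) auto
    obtain p :: nat where p: "prime p" "x \<le> real p" "real p \<le> C0 * x powr (1 + \<tau>)"
      using C0(2) x1 by blast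
    have p2: "p \<ge> 2" using p(1) by (rule prime_ge_2_nat)
    obtain S where S: "S \<subseteq> cube p I" "real p powr (u - \<delta>') \<le> 4 * real (card S)" "evasive_mod p I k r S"
      using r p2 I unfolding u_def by blast
    have fS: "finite S" using S(1) finite_cube[OF I(1)] by (rule finite_subset)
    have "u - \<delta>' \<ge> 0" using \<delta>'(2) u \<tau> by (smt (verit) divide_pos_pos mult_pos_neg)
    then have "x powr (u - \<delta>') \<le> real p powr (u - \<delta>')" using p(2) x1 by (intro powr_mono2) auto
    moreover have "x powr (u - \<delta>') = 4 * real n"
      unfolding x_def powr_powr \<delta>'(2) using n by simp
    ultimately have "n \<le> card S" using S(2) by simp
    then obtain S' where S': "S' \<subseteq> S" "card S' = n" by (metis obtain_subset_with_card_n)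
    have "x powr (1 + \<tau>) \<le> (4 * real n) powr (1 / u + \<delta>)"
      unfolding x_def powr_powr using n ex by (intro powr_mono) auto
    then have "C0 * x powr (1 + \<tau>) \<le> C0 * (4 * real n) powr (1 / u + \<delta>)"
      using C0(1) by (intro mult_left_mono) auto
    also have "\<dots> = C * real n powr (1 / u + \<delta>)" unfolding C_def by (simp add: powr_mult)
    finally have "real p \<le> C * real n powr (1 / u + \<delta>)" using p(3) by linarith
    then show "\<exists>p S. prime p \<and> real p \<le> C * real n powr (1 / (real D - real k) + \<delta>) \<and>
      S \<subseteq> cube p I \<and> card S = n \<and> evasive_mod p I k r S"
      using p(1) S' S(1) evasive_mod_subset[OF S(3) S'(1) fS] unfolding u_def by blast
  qed
qed

text \<open>The residues in \<open>{0..<p}\<close> serve directly as integer coordinates. Their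
  nonnegativity later lets padding hyperplanes miss every point.\<close>

lemma exists_points_evading_flats:
  fixes \<delta> :: real and k :: nat
  defines "d \<equiv> CARD('n::finite)"
  assumes \<delta>: "\<delta> > 0" and k: "k < d"
  shows "\<exists>r C. C \<ge> 1 \<and> (\<forall>n\<ge>1. \<exists>P :: ('n \<Rightarrow> int) set. finite P \<and> card P = n \<and>
    (\<forall>x\<in>P. \<forall>l. 0 \<le> x l \<and> real_of_int (x l) \<le> C * real n powr (1 / (real d - real k) + \<delta>)) \<and>
    (\<forall>T\<subseteq>P. \<forall>a. r \<le> card T \<longrightarrow> k < dim ((\<lambda>x. real_vec x - real_vec a) ` T)))"
proof -
  obtain r C where C: "C \<ge> 1" and rC: "\<forall>n\<ge>1. \<forall>I::'n set. finite I \<longrightarrow> card I = d \<longrightarrow>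
    (\<exists>p S. prime p \<and> real p \<le> C * real n powr (1 / (real d - real k) + \<delta>) \<and>
      S \<subseteq> cube p I \<and> card S = n \<and> evasive_mod p I k r S)"
    using exists_evasive_mod_card[OF \<delta> k] by (elim exE conjE)
  show ?thesis
  proof (rule exI[of _ r], rule exI[of _ C], intro conjI allI impI C)
    fix n :: nat assume n: "n \<ge> 1"
    obtain p and S :: "('n \<Rightarrow> int) set" where p: "prime p" "real p \<le> C * real n powr (1 / (real d - real k) + \<delta>)"
      and S: "S \<subseteq> cube p UNIV" "card S = n" "evasive_mod p UNIV k r S"
      using rC n unfolding d_def by (metis finite)
    have fS: "finite S" using S(1) by (rule finite_subset) (rule finite_cube, simp)
    have "0 \<le> x l \<and> real_of_int (x l) \<le> C * real n powr (1 / (real d - real k) + \<delta>)" if "x \<in> S" for x l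
    proof -
      have "x \<in> UNIV \<rightarrow>\<^sub>E {0..<int p}" using that S(1) unfolding cube_def by blast
      then have "x l \<in> {0..<int p}" by (rule PiE_mem) simp
      then show ?thesis using p(2) by (auto intro: order_trans[rotated])
    qed
    moreover have "k < dim ((\<lambda>x. real_vec x - real_vec a) ` T)" if T: "T \<subseteq> S" "r \<le> card T" for T a
    proof -
      obtain B where B: "B \<subseteq> T" "k < card B" "indep_mod p UNIV (\<lambda>b l. b l - a l) B"
        using evasive_mod_indep[OF p(1) fS S(3) T] by blast
      have fB: "finite B" using B(1) T(1) fS by (meson finite_subset)
      have "card B \<le> dim ((real_vec \<circ> (\<lambda>b l. b l - a l)) ` B)"
        using prime_gt_1_nat[OF p(1)] fB B(3) by (rule indep_mod_imp_dim)
      also have "(real_vec \<circ> (\<lambda>b l. b l - a l)) ` B = (\<lambda>x. real_vec x - real_vec a) ` B"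
        by (intro image_cong) (auto simp: real_vec_def vec_eq_iff)
      also have "dim \<dots> \<le> dim ((\<lambda>x. real_vec x - real_vec a) ` T)"
        using B(1) by (intro dim_subset image_mono)
      finally show ?thesis using B(2) by simp
    qed
    ultimately show "\<exists>P :: ('n \<Rightarrow> int) set. finite P \<and> card P = n \<and>
      (\<forall>x\<in>P. \<forall>l. 0 \<le> x l \<and> real_of_int (x l) \<le> C * real n powr (1 / (real d - real k) + \<delta>)) \<and>
      (\<forall>T\<subseteq>P. \<forall>a. r \<le> card T \<longrightarrow> k < dim ((\<lambda>x. real_vec x - real_vec a) ` T))"
      using fS S(2) by (intro exI[of _ S]) simp
  qed
qed

text \<open>Dirichlet approximation of the numbers \<open>s l / p\<close>, with the denominator bound balanced against
  the approximation quality.\<close>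

lemma exists_short_multiple_mod:
  fixes s :: "'n::finite \<Rightarrow> int"
  defines "d \<equiv> CARD('n)"
  assumes p: "p \<ge> 2" and d: "d \<ge> 2"
  shows "\<exists>v t. v l0 = t \<and> \<not> int p dvd t \<and> (\<forall>l. l \<noteq> l0 \<longrightarrow> [v l = t * s l] (mod int p)) \<and>
    (\<forall>l. \<bar>real_of_int (v l)\<bar> \<le> 2 * real p powr ((real d - 1) / real d))"
proof -
  \<comment> \<open>Approximating \<open>d - 1\<close> numbers with precision \<open>1 / N\<close>
    gives a multiplier up to \<open>N ^ (d - 1)\<close> and remainders up to \<open>p / N\<close>;
    both are of order \<open>R\<close> when \<open>N\<close> is about
    \<open>p powr (1 / d)\<close>.\<close>
  define y where "y = real p powr (1 / real d)"
  define N where "N = nat \<lfloor>y\<rfloor>"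
  have y1: "y \<ge> 1" unfolding y_def using p by (intro ge_one_powr_ge_zero) auto
  have "real N = of_int \<lfloor>y\<rfloor>" "\<lfloor>y\<rfloor> \<ge> 1" unfolding N_def using y1 by auto
  then have N: "N > 0" "real N \<le> y" "y \<le> 2 * real N" by linarith+
  define I where "I = UNIV - {l0}"
  have cI: "card I = d - 1" unfolding I_def d_def by (simp add: card_Diff_singleton)
  obtain h where h: "bij_betw h {..<d - 1} I"
    using cI by (metis bij_betw_from_nat_into_finite finite)
  define g where "g = inv_into {..<d - 1} h"
  have g: "g l < d - 1" "h (g l) = l" if "l \<noteq> l0" for l
    using h that unfolding g_def bij_betw_def I_def
    by (metis DiffI UNIV_I inv_into_into lessThan_iff singletonD,
        metis DiffI UNIV_I f_inv_into_f singletonD)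
  obtain q P where q: "0 < q" "q \<le> int (N ^ (d - 1))"
    and P: "\<And>i. i < d - 1 \<Longrightarrow> \<bar>of_int q * (s (h i) / real p) - of_int (P i)\<bar> < 1 / real N"
    using Dirichlet_approx_simult[OF N(1), of "d - 1" "\<lambda>i. s (h i) / real p"] by metis
  \<comment> \<open>This is \<open>q\<close> times the projective point with entry 1 at
    \<open>l0\<close> and entries \<open>s l\<close> elsewhere, reduced by multiples of
    \<open>p\<close>.\<close>
  define v where "v l = (if l = l0 then q else q * s l - int p * P (g l))" for l
  define R where "R = real p powr ((real d - 1) / real d)"
  have yR: "y ^ (d - 1) = R"
    unfolding y_def R_def using p d by (simp add: powr_realpow[symmetric] powr_powr of_nat_diff)
  have "real_of_int q \<le> real N ^ (d - 1)" using q(2) by (metis of_int_le_iff of_int_of_nat_eq of_nat_power)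
  also have "\<dots> \<le> y ^ (d - 1)" using N by (intro power_mono) auto
  finally have qR: "real_of_int q \<le> R" using yR by simp
  have "R < real p powr 1" unfolding R_def using p d by (intro powr_less_mono) auto
  then have "q < int p" using qR p by simp
  then have nd: "\<not> int p dvd q" using q(1) zdvd_not_zless by blast
  have pR: "real p / real N \<le> 2 * R"
  proof -
    have "real p = y * R"
      unfolding y_def R_def using p d by (simp flip: powr_add add_divide_distrib)
    also have "\<dots> \<le> 2 * real N * R" using N(3) unfolding R_def by (intro mult_right_mono) auto
    finally show ?thesis using N(1) by (simp add: field_simps)
  qed
  have "\<bar>real_of_int (v l)\<bar> \<le> 2 * R" for l
  proof (cases "l = l0")
    case True
    then show ?thesis using qR q(1) unfolding v_def by simp
  next
    case False
    have "\<bar>of_int q * (s l / real p) - of_int (P (g l))\<bar> < 1 / real N"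
      using P[of "g l"] g[OF False] by simp
    then have "real p * \<bar>of_int q * (s l / real p) - of_int (P (g l))\<bar> \<le> real p * (1 / real N)"
      by (intro mult_left_mono) auto
    moreover have "real p * \<bar>of_int q * (s l / real p) - of_int (P (g l))\<bar> = \<bar>real_of_int (v l)\<bar>"
    proof -
      have "real_of_int (v l) = real p * (of_int q * (s l / real p) - of_int (P (g l)))"
        unfolding v_def using False p by (simp add: field_simps)
      then show ?thesis by (simp add: abs_mult)
    qed
    ultimately show ?thesis using pR by simp
  qed
  moreover have "[v l = q * s l] (mod int p)" if "l \<noteq> l0" for l
    using that unfolding v_def by (simp add: cong_iff_dvd_diff)
  ultimately show ?thesis
    using nd unfolding R_def by (intro exI[of _ v] exI[of _ q]) (auto simp: v_def)
qed

text \<open>Read projectively, \<open>f b\<close> is the point with affine coordinates \<open>b\<close> in the chart \<open>l0 = 1\<close>.\<close>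

lemma indep_mod_lift:
  fixes f :: "('n \<Rightarrow> int) \<Rightarrow> 'n \<Rightarrow> int"
  assumes p: "prime p" and fB: "finite B"
    and f0: "\<And>b. b \<in> insert a B \<Longrightarrow> \<not> int p dvd f b l0"
    and f: "\<And>b l. b \<in> insert a B \<Longrightarrow> l \<noteq> l0 \<Longrightarrow> [f b l = f b l0 * b l] (mod int p)"
    and ind: "indep_mod p (UNIV - {l0}) (\<lambda>b l. b l - a l) B"
  shows "a \<notin> B" "indep_mod p UNIV f (insert a B)"
proof -
  show aB: "a \<notin> B"
  proof
    assume "a \<in> B"
    define c where "c b = (if b = a then 1 else 0::int)" for b
    have "(\<Sum>b\<in>B. c b * (b l - a l)) = 0" for l
      by (intro sum.neutral) (auto simp: c_def)
    then have "\<forall>l\<in>UNIV - {l0}. int p dvd (\<Sum>b\<in>B. c b * (b l - a l))" by simp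
    then have "\<forall>b\<in>B. int p dvd c b" using ind unfolding indep_mod_def by blast
    then have "int p dvd 1" using \<open>a \<in> B\<close> unfolding c_def by auto
    then show False using prime_gt_1_nat[OF p] by simp
  qed
  have pp: "prime (int p)" using p by simp
  show "indep_mod p UNIV f (insert a B)"
    unfolding indep_mod_def
  proof (intro allI impI)
    fix c assume c: "\<forall>l\<in>UNIV. int p dvd (\<Sum>b\<in>insert a B. c b * f b l)"
    \<comment> \<open>Absorbing the scalings turns the relation into an affine one: coordinate
      \<open>l0\<close> says that the \<open>e b\<close> sum to 0 modulo \<open>p\<close>, so
      \<open>a l\<close> may be subtracted in the others and the term at \<open>a\<close> drops
      out.\<close>
    define e where "e b = c b * f b l0" for b
    have e0: "int p dvd (\<Sum>b\<in>insert a B. e b)" using c unfolding e_def by blast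
    have "int p dvd (\<Sum>b\<in>B. e b * (b l - a l))" if l: "l \<in> UNIV - {l0}" for l
    proof -
      have "[(\<Sum>b\<in>insert a B. c b * f b l) = (\<Sum>b\<in>insert a B. c b * (f b l0 * b l))] (mod int p)"
        using f l by (intro cong_sum cong_mult) auto
      moreover have "int p dvd (\<Sum>b\<in>insert a B. c b * f b l)" using c by blast
      ultimately have "int p dvd (\<Sum>b\<in>insert a B. c b * (f b l0 * b l))" by (simp only: cong_dvd_iff)
      then have "int p dvd (\<Sum>b\<in>insert a B. c b * (f b l0 * b l)) - (\<Sum>b\<in>insert a B. e b) * a l"
        using e0 by (intro dvd_diff dvd_mult2)
      also have "\<dots> = (\<Sum>b\<in>insert a B. e b * (b l - a l))"
        unfolding sum_distrib_right e_def by (simp only: right_diff_distrib sum_subtractf mult.assoc)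
      also have "\<dots> = (\<Sum>b\<in>B. e b * (b l - a l))" using fB aB by simp
      finally show ?thesis .
    qed
    then have eB: "\<forall>b\<in>B. int p dvd e b" using ind unfolding indep_mod_def by blast
    then have "int p dvd (\<Sum>b\<in>B. e b)" by (intro dvd_sum) blast
    moreover have "int p dvd e a + (\<Sum>b\<in>B. e b)" using e0 fB aB by simp
    ultimately have "int p dvd e a" by (simp add: dvd_add_left_iff)
    then have "\<forall>b\<in>insert a B. int p dvd e b" using eB by blast
    then show "\<forall>b\<in>insert a B. int p dvd c b"
      using f0 pp unfolding e_def by (metis prime_dvd_mult_iff)
  qed
qed

text \<open>The cross-multiplication clause makes the normals pairwise non-parallel, so that
  hyperplanes with different normals will be distinct.\<close>

lemma exists_normals_evading_subspaces:
  fixes \<delta> :: real and k :: nat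
  defines "d \<equiv> CARD('n::finite)"
  assumes \<delta>: "\<delta> > 0" and k: "k + 2 \<le> d"
  shows "\<exists>r C. C \<ge> 1 \<and> (\<forall>n\<ge>1. \<exists>V :: ('n \<Rightarrow> int) set. finite V \<and> card V = n \<and>
    (\<forall>v\<in>V. \<forall>l. \<bar>real_of_int (v l)\<bar>
       \<le> C * real n powr ((1 / (real k + 1) + \<delta>) * ((real d - 1) / real d))) \<and>
    (\<forall>v\<in>V. v l0 \<noteq> 0) \<and>
    (\<forall>v\<in>V. \<forall>v'\<in>V. (\<forall>l. v l0 * v' l = v l * v' l0) \<longrightarrow> v = v') \<and>
    (\<forall>T\<subseteq>V. r \<le> card T \<longrightarrow> d - k \<le> dim (real_vec ` T)))"
proof -
  \<comment> \<open>An affine \<open>\<kappa>\<close>-flat of the chart spans a linear subspace of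
    dimension \<open>d - k - 1\<close>. Its codimension in the chart is \<open>k + 1\<close>, whence
    a prime of about \<open>n powr (1 / (k + 1))\<close>.\<close>
  define \<kappa> where "\<kappa> = d - k - 2"
  have \<kappa>: "\<kappa> < d - 1" "real (d - 1) - real \<kappa> = real k + 1" unfolding \<kappa>_def using k by auto
  define I where "I = UNIV - {l0}"
  have cI: "card I = d - 1" unfolding I_def d_def by (simp add: card_Diff_singleton)
  obtain r C0 where C0: "C0 \<ge> 1" and rC: "\<forall>n\<ge>1. \<forall>I::'n set. finite I \<longrightarrow> card I = d - 1 \<longrightarrow>
    (\<exists>p S. prime p \<and> real p \<le> C0 * real n powr (1 / (real (d - 1) - real \<kappa>) + \<delta>) \<and>
      S \<subseteq> cube p I \<and> card S = n \<and> evasive_mod p I \<kappa> r S)"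
    using exists_evasive_mod_card[OF \<delta> \<kappa>(1)] by (elim exE conjE)
  define \<rho> where "\<rho> = (real d - 1) / real d"
  have \<rho>: "0 \<le> \<rho>" unfolding \<rho>_def using k by simp
  define C where "C = 2 * C0 powr \<rho>"
  have "1 \<le> C0 powr \<rho>" using C0 \<rho> by (rule ge_one_powr_ge_zero)
  then have C: "C \<ge> 1" unfolding C_def by simp
  show ?thesis
  proof (rule exI[of _ r], rule exI[of _ C], intro conjI allI impI C)
    fix n :: nat assume n: "n \<ge> 1"
    obtain p S where p: "prime p" "real p \<le> C0 * real n powr (1 / (real k + 1) + \<delta>)"
      and S: "S \<subseteq> cube p I" "card S = n" "evasive_mod p I \<kappa> r S"
      using rC n cI unfolding \<kappa>(2) by (metis finite)
    have p2: "p \<ge> 2" using p(1) by (rule prime_ge_2_nat)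
    have fS: "finite S" using S(1) by (rule finite_subset) (rule finite_cube, simp)
    have pp: "prime (int p)" using p(1) by simp
    obtain f where f0: "\<And>s. \<not> int p dvd f s l0"
      and f1: "\<And>s l. l \<noteq> l0 \<Longrightarrow> [f s l = f s l0 * s l] (mod int p)"
      and fb: "\<And>s l. \<bar>real_of_int (f s l)\<bar> \<le> 2 * real p powr \<rho>"
    proof -
      have "\<forall>s. \<exists>v. \<not> int p dvd v l0 \<and> (\<forall>l. l \<noteq> l0 \<longrightarrow> [v l = v l0 * s l] (mod int p)) \<and>
          (\<forall>l. \<bar>real_of_int (v l)\<bar> \<le> 2 * real p powr \<rho>)"
      proof
        fix s :: "'n \<Rightarrow> int"
        have "CARD('n) \<ge> 2" using k unfolding d_def by simp
        from exists_short_multiple_mod[OF p2 this, of l0 s]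
        show "\<exists>v. \<not> int p dvd v l0 \<and> (\<forall>l. l \<noteq> l0 \<longrightarrow> [v l = v l0 * s l] (mod int p)) \<and>
          (\<forall>l. \<bar>real_of_int (v l)\<bar> \<le> 2 * real p powr \<rho>)"
          unfolding d_def \<rho>_def by blast
      qed
      then have "\<exists>f. \<forall>s. \<not> int p dvd f s l0 \<and> (\<forall>l. l \<noteq> l0 \<longrightarrow> [f s l = f s l0 * s l] (mod int p)) \<and>
          (\<forall>l. \<bar>real_of_int (f s l)\<bar> \<le> 2 * real p powr \<rho>)"
        by (rule choice)
      then obtain f where f: "\<forall>s. \<not> int p dvd f s l0 \<and>
          (\<forall>l. l \<noteq> l0 \<longrightarrow> [f s l = f s l0 * s l] (mod int p)) \<and>
          (\<forall>l. \<bar>real_of_int (f s l)\<bar> \<le> 2 * real p powr \<rho>)"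
        by (elim exE)
      show ?thesis by (rule that[of f]) (simp_all add: f)
    qed
    \<comment> \<open>Proportional representatives define the same affine point modulo
      \<open>p\<close>, because their \<open>l0\<close> entries are units; at \<open>l0\<close>
      itself both functions take the extensional default value.\<close>
    have par: "s = s'" if s: "s \<in> S" "s' \<in> S" and eq: "\<forall>l. f s l0 * f s' l = f s l * f s' l0" for s s'
    proof (rule ext)
      fix l
      show "s l = s' l"
      proof (cases "l = l0")
        case True
        have E: "s \<in> I \<rightarrow>\<^sub>E {0..<int p}" "s' \<in> I \<rightarrow>\<^sub>E {0..<int p}" "l \<notin> I"
          using s S(1) True unfolding cube_def I_def by blast+
        show ?thesis unfolding PiE_arb[OF E(1,3)] PiE_arb[OF E(2,3)] by (rule refl)
      next
        case False
        have "[f s l0 * f s' l = f s l0 * (f s' l0 * s' l)] (mod int p)"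
          using f1[OF False] by (rule cong_mult[OF cong_refl])
        moreover have "[f s l * f s' l0 = f s l0 * s l * f s' l0] (mod int p)"
          using f1[OF False] by (rule cong_mult[OF _ cong_refl])
        ultimately have "[f s l0 * s l * f s' l0 = f s l0 * (f s' l0 * s' l)] (mod int p)"
          using spec[OF eq, of l] unfolding cong_def by presburger
        then have "int p dvd f s l0 * f s' l0 * (s l - s' l)"
          by (simp only: cong_iff_dvd_diff right_diff_distrib mult_ac)
        then have "int p dvd s l - s' l" using f0 pp by (meson prime_dvd_mult_iff)
        then have "s l mod int p = s' l mod int p" by (simp add: mod_eq_dvd_iff)
        moreover have "s l mod int p = s l" "s' l mod int p = s' l"
          using s S(1) False unfolding I_def by (auto intro!: cube_mod_eq[of _ p I, unfolded I_def])
        ultimately show ?thesis by simp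
      qed
    qed
    have inj: "inj_on f S" by (rule inj_onI) (rule par, auto)
    have bound: "\<bar>real_of_int (f s l)\<bar> \<le> C * real n powr ((1 / (real k + 1) + \<delta>) * \<rho>)" for s l
    proof -
      have "real p powr \<rho> \<le> (C0 * real n powr (1 / (real k + 1) + \<delta>)) powr \<rho>"
        using p(2) \<rho> by (intro powr_mono2) auto
      also have "\<dots> = C0 powr \<rho> * real n powr ((1 / (real k + 1) + \<delta>) * \<rho>)"
        using C0 by (simp add: powr_mult powr_powr)
      finally show ?thesis using fb[of s l] unfolding C_def by simp
    qed
    have dim: "d - k \<le> dim (real_vec ` T)" if T: "T \<subseteq> f ` S" "r \<le> card T" for T
    proof -
      obtain T' where T': "T' \<subseteq> S" "T = f ` T'" using T(1) by (meson subset_imageE)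
      have cT: "card T = card T'"
        unfolding T'(2) using inj T'(1) by (intro card_image) (rule inj_on_subset)
      have "r > 0" using S(3) unfolding evasive_mod_def by (metis not_less_zero neq0_conv)
      then have "T' \<noteq> {}" using T(2) cT by auto
      then obtain a where a: "a \<in> T'" by blast
      obtain B where B: "B \<subseteq> T'" "\<kappa> < card B" "indep_mod p I (\<lambda>b l. b l - a l) B"
        using evasive_mod_indep[OF p(1) fS S(3) T'(1), of a] T(2) cT by auto
      have fB: "finite B" using B(1) T'(1) fS by (meson finite_subset)
      have aB: "a \<notin> B" and ind: "indep_mod p UNIV f (insert a B)"
        using indep_mod_lift[OF p(1) fB f0 f1 B(3)[unfolded I_def]] by auto
      \<comment> \<open>At least \<open>\<kappa> + 1\<close> differences together with the base
        point \<open>a\<close> give \<open>\<kappa> + 2 = d - k\<close> independent normals.\<close>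
      have "d - k \<le> card (insert a B)" using B(2) aB fB unfolding \<kappa>_def by simp
      also have "\<dots> \<le> dim ((real_vec \<circ> f) ` insert a B)"
        using p2 fB ind by (intro indep_mod_imp_dim) auto
      also have "\<dots> \<le> dim (real_vec ` T)"
        using B(1) a T'(2) by (intro dim_subset) auto
      finally show ?thesis .
    qed
    show "\<exists>V :: ('n \<Rightarrow> int) set. finite V \<and> card V = n \<and>
    (\<forall>v\<in>V. \<forall>l. \<bar>real_of_int (v l)\<bar>
       \<le> C * real n powr ((1 / (real k + 1) + \<delta>) * ((real d - 1) / real d))) \<and>
    (\<forall>v\<in>V. v l0 \<noteq> 0) \<and>
    (\<forall>v\<in>V. \<forall>v'\<in>V. (\<forall>l. v l0 * v' l = v l * v' l0) \<longrightarrow> v = v') \<and>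
    (\<forall>T\<subseteq>V. r \<le> card T \<longrightarrow> d - k \<le> dim (real_vec ` T))"
    proof (intro exI[of _ "f ` S"] conjI)
      show "finite (f ` S)" using fS by simp
      show "card (f ` S) = n" using card_image[OF inj] S(2) by simp
      show "\<forall>v\<in>f ` S. \<forall>l. \<bar>real_of_int (v l)\<bar>
         \<le> C * real n powr ((1 / (real k + 1) + \<delta>) * ((real d - 1) / real d))"
        using bound unfolding \<rho>_def by blast
      show "\<forall>v\<in>f ` S. v l0 \<noteq> 0" using f0 by (metis (no_types, lifting) dvd_0_right imageE)
      show "\<forall>v\<in>f ` S. \<forall>v'\<in>f ` S. (\<forall>l. v l0 * v' l = v l * v' l0) \<longrightarrow> v = v'"
        using par by blast
      show "\<forall>T\<subseteq>f ` S. r \<le> card T \<longrightarrow> d - k \<le> dim (real_vec ` T)" using dim by blast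
    qed
  qed
qed

section \<open>Incidences\<close>

lemma contains_Krr_mono:
  assumes "contains_Krr r P H" "r' \<le> r"
  shows "contains_Krr r' P H"
proof -
  obtain A B where AB: "A \<subseteq> P" "B \<subseteq> H" "card A = r" "card B = r" "\<forall>p\<in>A. \<forall>h\<in>B. p \<in> h"
    using assms(1) unfolding contains_Krr_def by blast
  obtain A' where A': "A' \<subseteq> A" "card A' = r'" using AB(3) assms(2) by (metis obtain_subset_with_card_n)
  obtain B' where B': "B' \<subseteq> B" "card B' = r'" using AB(4) assms(2) by (metis obtain_subset_with_card_n)
  have "A' \<subseteq> P" "B' \<subseteq> H" "\<forall>p\<in>A'. \<forall>h\<in>B'. p \<in> h" using AB(1,2,5) A'(1) B'(1) by blast+
  then show ?thesis using A'(2) B'(2) unfolding contains_Krr_def by (intro exI[of _ A'] exI[of _ B'] conjI)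
qed

text \<open>The points of a \<open>K\<^sub>r\<^sub>,\<^sub>r\<close> have differences orthogonal to all of its normals, so the two
  spans have total dimension at most \<open>d\<close>.\<close>

lemma not_contains_Krr:
  fixes P :: "(real ^ 'n::finite) set" and N :: "(real ^ 'n) set"
  assumes r: "r > 0"
    and P: "\<And>T a. T \<subseteq> P \<Longrightarrow> a \<in> P \<Longrightarrow> card T = r \<Longrightarrow> k < dim ((\<lambda>x. x - a) ` T)"
    and N: "\<And>U. U \<subseteq> N \<Longrightarrow> card U = r \<Longrightarrow> CARD('n) - k \<le> dim U"
    and H: "\<And>h x. h \<in> H \<Longrightarrow> x \<in> P \<Longrightarrow> x \<in> h \<Longrightarrow> \<exists>v\<in>N. \<exists>c. h = {y. v \<bullet> y = c}"
  shows "\<not> contains_Krr r P H"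
proof
  assume "contains_Krr r P H"
  then obtain A B where AB: "A \<subseteq> P" "B \<subseteq> H" "card A = r" "card B = r" "\<forall>p\<in>A. \<forall>h\<in>B. p \<in> h"
    unfolding contains_Krr_def by blast
  have "A \<noteq> {}" using AB(3) r by auto
  then obtain a where a: "a \<in> A" by blast
  have "\<exists>v\<in>N. h = {y. v \<bullet> y = v \<bullet> a}" if h: "h \<in> B" for h
  proof -
    have ah: "h \<in> H" "a \<in> P" "a \<in> h" using AB(1,2,5) a h by auto
    obtain v c where v: "v \<in> N" "h = {y. v \<bullet> y = c}" using H[OF ah] by (elim bexE exE)
    moreover from this have "c = v \<bullet> a" using ah(3) by simp
    ultimately show ?thesis by blast
  qed
  then have "\<forall>h\<in>B. \<exists>v. v \<in> N \<and> h = {y. v \<bullet> y = v \<bullet> a}" by blast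
  then obtain f where "\<forall>h\<in>B. f h \<in> N \<and> h = {y. f h \<bullet> y = f h \<bullet> a}"
    by (elim bchoice[THEN exE])
  then have f: "f h \<in> N" "h = {y. f h \<bullet> y = f h \<bullet> a}" if "h \<in> B" for h
    using that by (blast, blast)
  \<comment> \<open>All hyperplanes of \<open>B\<close> pass through \<open>a\<close>, so each is
    determined by its normal.\<close>
  have "inj_on f B"
  proof (rule inj_onI)
    fix h h' assume h: "h \<in> B" "h' \<in> B" and eq: "f h = f h'"
    have "h = {y. f h \<bullet> y = f h \<bullet> a}" using h(1) by (rule f(2))
    also have "\<dots> = {y. f h' \<bullet> y = f h' \<bullet> a}" unfolding eq ..
    also have "\<dots> = h'" using h(2) by (rule f(2)[symmetric])
    finally show "h = h'" .
  qed
  then have "card (f ` B) = r" using AB(4) by (simp only: card_image)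
  moreover have "f ` B \<subseteq> N" using f(1) by (rule image_subsetI)
  ultimately have "CARD('n) - k \<le> dim (f ` B)" by (intro N)
  moreover have "k < dim ((\<lambda>x. x - a) ` A)" using AB(1) subsetD[OF AB(1) a] AB(3) by (rule P)
  moreover have "dim (f ` B \<union> (\<lambda>x. x - a) ` A) = dim (f ` B) + dim ((\<lambda>x. x - a) ` A)"
  proof (rule dim_orthogonal_sum)
    fix x y assume "x \<in> f ` B" "y \<in> (\<lambda>x. x - a) ` A"
    then obtain h z where hz: "h \<in> B" "x = f h" "z \<in> A" "y = z - a" by blast
    have "z \<in> h" using AB(5) hz by blast
    then have "z \<in> {y. f h \<bullet> y = f h \<bullet> a}" by (subst f(2)[OF hz(1), symmetric])
    then have "f h \<bullet> z = f h \<bullet> a" by simp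
    then show "x \<bullet> y = 0" using hz by (simp add: inner_diff_right)
  qed
  moreover have "dim (f ` B \<union> (\<lambda>x. x - a) ` A) \<le> CARD('n)"
    using dim_subset_UNIV[of "f ` B \<union> (\<lambda>x. x - a) ` A"] by simp
  ultimately show False by linarith
qed

section \<open>Hyperplanes with integer normals through integer points\<close>

lemma real_vec_inject: "real_vec x = real_vec y \<longleftrightarrow> x = y"
  unfolding real_vec_def by (auto simp: vec_eq_iff)

lemma inj_real_vec: "inj_on real_vec A"
  by (rule inj_onI) (simp add: real_vec_inject)

definition int_hyperplane :: "('n::finite \<Rightarrow> int) \<Rightarrow> ('n \<Rightarrow> int) \<Rightarrow> (real ^ 'n) set" where
  "int_hyperplane v x = {y. real_vec v \<bullet> y = real_vec v \<bullet> real_vec x}"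

text \<open>The vector \<open>e\<close> is orthogonal to \<open>v\<close>, hence a direction of the
  common hyperplane, hence orthogonal to \<open>v'\<close> as well.\<close>

lemma int_hyperplane_eq_imp_parallel:
  assumes eq: "int_hyperplane v x = int_hyperplane v' x'"
  shows "v l0 * v' l = v l * v' l0"
proof -
  define e where "e = axis l (real_of_int (v l0)) - axis l0 (real_of_int (v l))"
  have inner: "real_vec u \<bullet> e = u l * v l0 - u l0 * v l" for u
    unfolding e_def by (simp add: inner_diff_right inner_axis real_vec_def)
  have "real_vec x \<in> int_hyperplane v x" "real_vec x + e \<in> int_hyperplane v x"
    unfolding int_hyperplane_def by (simp_all add: inner_add_right inner)
  then have "real_vec v' \<bullet> e = 0"
    unfolding eq by (simp add: int_hyperplane_def inner_add_right)
  then have "real_of_int (v' l * v l0) = real_of_int (v' l0 * v l)" unfolding inner by simp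
  then show ?thesis by (simp only: of_int_eq_iff mult.commute)
qed

text \<open>A member is fixed by its normal and an integer inner product of absolute value at most
  \<open>M\<close>, so each normal has at most \<open>2 * M + 1\<close> translates, however many
  points there are; \<open>M \<ge> 1\<close> bounds this by \<open>3 * M\<close>.\<close>

lemma card_int_hyperplanes_le:
  fixes P V :: "('n::finite \<Rightarrow> int) set"
  assumes V: "finite V" and R: "\<And>v l. v \<in> V \<Longrightarrow> \<bar>real_of_int (v l)\<bar> \<le> R"
    and L: "\<And>x l. x \<in> P \<Longrightarrow> \<bar>real_of_int (x l)\<bar> \<le> L" and LR: "L \<ge> 1" "R \<ge> 1"
  defines "H \<equiv> {int_hyperplane v x | v x. v \<in> V \<and> x \<in> P}"
  shows "finite H" "real (card H) \<le> 3 * real CARD('n) * L * R * real (card V)"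
proof -
  define M where "M = \<lfloor>real CARD('n) * (R * L)\<rfloor>"
  have "1 * 1 \<le> R * L" using LR by (intro mult_mono) auto
  then have RL: "1 \<le> R * L" by simp
  have "1 * 1 \<le> real CARD('n) * (R * L)" using RL by (intro mult_mono) (auto simp: Suc_leI)
  then have M: "real_of_int M \<le> real CARD('n) * (R * L)" "M \<ge> 1" unfolding M_def by simp_all
  let ?g = "\<lambda>(v, z). {y. real_vec v \<bullet> y = real_of_int z}"
  have sub: "H \<subseteq> ?g ` (V \<times> {-M..M})"
  proof
    fix h assume "h \<in> H"
    then obtain v x where vx: "v \<in> V" "x \<in> P" "h = int_hyperplane v x" unfolding H_def by blast
    define z where "z = (\<Sum>l\<in>UNIV. v l * x l)"
    have z: "real_vec v \<bullet> real_vec x = real_of_int z"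
      unfolding z_def real_vec_def by (simp add: inner_vec_def)
    have "\<bar>real_of_int z\<bar> \<le> (\<Sum>l\<in>UNIV. \<bar>real_of_int (v l) * real_of_int (x l)\<bar>)"
      unfolding z_def of_int_sum of_int_mult by (rule sum_abs)
    also have "\<dots> \<le> (\<Sum>l\<in>(UNIV::'n set). R * L)"
      unfolding abs_mult using R L vx LR by (intro sum_mono mult_mono) auto
    also have "\<dots> = real CARD('n) * (R * L)" by simp
    finally have "\<bar>z\<bar> \<le> M" unfolding M_def by (simp add: le_floor_iff)
    then have "(v, z) \<in> V \<times> {-M..M}" using vx by auto
    moreover have "h = ?g (v, z)" using vx z by (simp add: int_hyperplane_def)
    ultimately show "h \<in> ?g ` (V \<times> {-M..M})" by (rule rev_image_eqI)
  qed
  have fin: "finite (V \<times> {-M..M})" using V by simp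
  show "finite H" using sub fin by (rule finite_surj[rotated])
  have "card H \<le> card (V \<times> {-M..M})" using fin sub by (rule surj_card_le)
  also have "\<dots> = card V * nat (2 * M + 1)" by (simp add: card_cartesian_product)
  finally have "real (card H) \<le> real (card V * nat (2 * M + 1))" by (simp only: of_nat_le_iff)
  also have "\<dots> = real (card V) * (2 * real_of_int M + 1)" using M(2) by simp
  also have "\<dots> \<le> real (card V) * (3 * (real CARD('n) * (R * L)))"
    using M by (intro mult_left_mono) auto
  finally show "real (card H) \<le> 3 * real CARD('n) * L * R * real (card V)" by (simp add: mult_ac)
qed

text \<open>Brings the arrangement to exactly \<open>m\<close> members without touching points whose
  coordinates are nonnegative.\<close>

lemma exists_padding_hyperplanes:
  fixes l :: "'n::finite" and q :: nat
  shows "\<exists>K :: (real ^ 'n) set set. finite K \<and> card K = q \<and> (\<forall>h\<in>K. is_hyperplane h) \<and>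
    (\<forall>h\<in>K. \<forall>x\<in>h. x $ l < 0)"
proof -
  define g where "g t = {x :: real ^ 'n. x $ l = - real t - 1}" for t :: nat
  have "inj g"
  proof (rule injI)
    fix s t assume eq: "g s = g t"
    have "axis l (- real s - 1) \<in> g s" unfolding g_def by (simp add: axis_def)
    then show "s = t" unfolding eq by (simp add: g_def axis_def)
  qed
  then have "card (g ` {..<q}) = q" by (simp add: card_image inj_on_subset)
  moreover have "is_hyperplane (g t)" for t
    unfolding is_hyperplane_def g_def
    by (intro exI[of _ "axis l 1"] exI[of _ "- real t - 1"])
      (simp add: inner_axis' axis_eq_0_iff)
  moreover have "\<forall>x\<in>g t. x $ l < 0" for t unfolding g_def by simp
  ultimately show ?thesis by (intro exI[of _ "g ` {..<q}"]) simp
qed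

lemma inc_ge:
  assumes "finite P" "finite H" "inj_on f X" "\<And>x. x \<in> X \<Longrightarrow> f x \<in> {(p, h). p \<in> P \<and> h \<in> H \<and> p \<in> h}"
  shows "card X \<le> inc P H"
  unfolding inc_def
proof (rule card_inj_on_le[OF assms(3)])
  show "f ` X \<subseteq> {(p, h). p \<in> P \<and> h \<in> H \<and> p \<in> h}"
    by (rule image_subsetI) (rule assms(4))
  have "{(p, h). p \<in> P \<and> h \<in> H \<and> p \<in> h} \<subseteq> P \<times> H" by blast
  then show "finite {(p, h). p \<in> P \<and> h \<in> H \<and> p \<in> h}"
    by (rule finite_subset) (rule finite_cartesian_product[OF assms(1,2)])
qed

text \<open>With \<open>w\<close> normals, every point lies on \<open>w\<close> distinct
  hyperplanes. In the exponent of \<open>w\<close>, the 1 counts the normals and the rest, up to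
  \<open>\<delta>\<close>, is the size of their entries.\<close>

lemma exists_grid_incidences:
  fixes \<delta> :: real and k :: nat
  defines "d \<equiv> CARD('n::finite)"
  assumes \<delta>: "\<delta> > 0" and k: "k + 2 \<le> d"
  shows "\<exists>r C. C \<ge> 1 \<and> (\<forall>n\<ge>1. \<forall>w\<ge>1. \<forall>m.
    C * real n powr (1 / (real d - real k) + \<delta>)
      * real w powr (1 + (real d - 1) / (real d * (real k + 1)) + \<delta>) \<le> real m \<longrightarrow>
    (\<exists>(P :: (real ^ 'n) set) H. finite P \<and> card P = n \<and> finite H \<and> card H = m \<and>
       (\<forall>h\<in>H. is_hyperplane h) \<and> \<not> contains_Krr r P H \<and> n * w \<le> inc P H))"
proof -
  define l0 where "l0 = (undefined :: 'n)"
  define a where "a = 1 / (real d - real k) + \<delta>"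
  define b where "b = (real d - 1) / (real d * (real k + 1)) + \<delta>"
  define b' where "b' = (1 / (real k + 1) + \<delta>) * ((real d - 1) / real d)"
  have kd: "k < d" using k by simp
  have a0: "a \<ge> 0" unfolding a_def using k \<delta> by simp
  have b0: "b \<ge> 0" unfolding b_def using k \<delta> by simp
  have "\<delta> * ((real d - 1) / real d) \<le> \<delta> * 1" using \<delta> k by (intro mult_left_mono) auto
  moreover have "b' = (real d - 1) / (real d * (real k + 1)) + \<delta> * ((real d - 1) / real d)"
    unfolding b'_def distrib_right[of "1 / (real k + 1)"] times_divide_times_eq mult_1
    by (simp only: mult.commute)
  ultimately have b'b: "b' \<le> b" unfolding b_def by linarith
  obtain r1 C1 where C1: "C1 \<ge> 1" and P1: "\<forall>n\<ge>1. \<exists>P :: ('n \<Rightarrow> int) set. finite P \<and> card P = n \<and>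
      (\<forall>x\<in>P. \<forall>l. 0 \<le> x l \<and> real_of_int (x l) \<le> C1 * real n powr a) \<and>
      (\<forall>T\<subseteq>P. \<forall>a. r1 \<le> card T \<longrightarrow> k < dim ((\<lambda>x. real_vec x - real_vec a) ` T))"
    using exists_points_evading_flats[OF \<delta> kd[unfolded d_def], folded d_def, folded a_def] by (elim exE conjE)
  obtain r2 C2 where C2: "C2 \<ge> 1" and V1: "\<forall>n\<ge>1. \<exists>V :: ('n \<Rightarrow> int) set. finite V \<and> card V = n \<and>
      (\<forall>v\<in>V. \<forall>l. \<bar>real_of_int (v l)\<bar> \<le> C2 * real n powr b') \<and> (\<forall>v\<in>V. v l0 \<noteq> 0) \<and>
      (\<forall>v\<in>V. \<forall>v'\<in>V. (\<forall>l. v l0 * v' l = v l * v' l0) \<longrightarrow> v = v') \<and>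
      (\<forall>T\<subseteq>V. r2 \<le> card T \<longrightarrow> d - k \<le> dim (real_vec ` T))"
    using exists_normals_evading_subspaces[OF \<delta> k[unfolded d_def], of l0, folded d_def, folded b'_def]
    by (elim exE conjE)
  \<comment> \<open>Both evasion properties persist for larger thresholds; the 1 guarantees a point
    to serve as base of the differences.\<close>
  define r where "r = max (max r1 r2) 1"
  define C where "C = 3 * real d * C1 * C2"
  have "1 \<le> 3 * real d * C1 * C2"
    using mult_mono[of 1 "3 * real d" 1 C1] mult_mono[of 1 "3 * real d * C1" 1 C2] k C1 C2 by simp
  then have C: "C \<ge> 1" unfolding C_def .
  have main: "\<exists>(P :: (real ^ 'n) set) H. finite P \<and> card P = n \<and> finite H \<and> card H = m \<and>
       (\<forall>h\<in>H. is_hyperplane h) \<and> \<not> contains_Krr r P H \<and> n * w \<le> inc P H"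
    if n: "n \<ge> 1" and w: "w \<ge> 1" and m: "C * real n powr a * real w powr (1 + b) \<le> real m" for n w m
  proof -
    obtain P where P: "finite P" "card P = n"
        "\<And>x l. x \<in> P \<Longrightarrow> 0 \<le> x l \<and> real_of_int (x l) \<le> C1 * real n powr a"
      and Pdim: "\<And>T a. T \<subseteq> P \<Longrightarrow> r1 \<le> card T \<Longrightarrow> k < dim ((\<lambda>x. real_vec x - real_vec (a :: 'n \<Rightarrow> int)) ` T)"
      using P1 n by metis
    obtain V where V: "finite V" "card V = w"
        "\<And>v l. v \<in> V \<Longrightarrow> \<bar>real_of_int (v (l::'n))\<bar> \<le> C2 * real w powr b'"
        "\<And>v. v \<in> V \<Longrightarrow> v l0 \<noteq> 0"
      and par: "\<And>v v'. v \<in> V \<Longrightarrow> v' \<in> V \<Longrightarrow> \<forall>l. v l0 * v' l = v l * v' l0 \<Longrightarrow> v = v'"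
      and Vdim: "\<And>T. T \<subseteq> V \<Longrightarrow> r2 \<le> card T \<Longrightarrow> d - k \<le> dim (real_vec ` T)"
      using V1 w by metis
    define L where "L = C1 * real n powr a"
    define R where "R = C2 * real w powr b"
    have "1 \<le> real n powr a" "1 \<le> real w powr b"
      using n w a0 b0 by (auto intro!: ge_one_powr_ge_zero)
    then have LR: "L \<ge> 1" "R \<ge> 1"
      unfolding L_def R_def using C1 C2 mult_mono[of 1 C1 1 "real n powr a"] mult_mono[of 1 C2 1 "real w powr b"]
      by auto
    have "real w powr b' \<le> real w powr b" using w b'b by (intro powr_mono) auto
    then have "C2 * real w powr b' \<le> R" unfolding R_def using C2 by (intro mult_left_mono) auto
    then have VR: "\<bar>real_of_int (v l)\<bar> \<le> R" if "v \<in> V" for v l using V(3)[OF that, of l] by linarith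
    have PL: "\<bar>real_of_int (x l)\<bar> \<le> L" if "x \<in> P" for x l using P(3)[OF that, of l] unfolding L_def by simp
    define H0 where "H0 = {int_hyperplane v x | v x. v \<in> V \<and> x \<in> P}"
    have fH0: "finite H0"
      unfolding H0_def by (rule card_int_hyperplanes_le(1)[of V R P L]) (fact V(1) VR PL LR)+
    have "real (card H0) \<le> 3 * real CARD('n) * L * R * real (card V)"
      unfolding H0_def by (rule card_int_hyperplanes_le(2)[of V R P L]) (fact V(1) VR PL LR)+
    then have "real (card H0) \<le> 3 * real d * L * R * real w" unfolding V(2) d_def .
    also have "3 * real d * L * R * real w = C * real n powr a * real w powr (1 + b)"
      unfolding L_def R_def C_def using w by (simp add: powr_add mult_ac)
    finally have cH0: "card H0 \<le> m" using m by simp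
    obtain K :: "(real ^ 'n) set set" where K: "finite K" "card K = m - card H0" "\<And>h. h \<in> K \<Longrightarrow> is_hyperplane h"
        "\<And>h x. h \<in> K \<Longrightarrow> x \<in> h \<Longrightarrow> x $ l0 < 0"
      using exists_padding_hyperplanes[of "m - card H0" l0] by metis
    have K_avoids: "real_vec x \<notin> h" if "h \<in> K" "x \<in> P" for h x
      using K(4)[OF that(1), of "real_vec x"] P(3)[OF that(2), of l0] by (auto simp: real_vec_def)
    have mem: "real_vec x \<in> int_hyperplane v x" for x and v :: "'n \<Rightarrow> int" by (simp add: int_hyperplane_def)
    have "H0 \<inter> K = {}" using mem K_avoids unfolding H0_def by blast
    then have cH: "card (H0 \<union> K) = m"
      using fH0 K(1,2) cH0 by (simp add: card_Un_disjoint)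
    have hyp: "is_hyperplane h" if "h \<in> H0" for h
    proof -
      obtain v x where vx: "v \<in> V" "h = int_hyperplane v x" using \<open>h \<in> H0\<close> unfolding H0_def by blast
      have "real_vec v $ l0 \<noteq> 0" using V(4)[OF vx(1)] by (simp add: real_vec_def)
      then have "real_vec v \<noteq> 0" by auto
      then show ?thesis unfolding is_hyperplane_def vx(2) int_hyperplane_def by blast
    qed
    have "card (P \<times> V) \<le> inc (real_vec ` P) (H0 \<union> K)"
    proof (rule inc_ge)
      show "finite (real_vec ` P)" "finite (H0 \<union> K)" using P(1) fH0 K(1) by auto
      show "inj_on (\<lambda>(x, v). (real_vec x, int_hyperplane v x)) (P \<times> V)"
      proof (rule inj_onI, clarify)
        fix x v x' v' assume v: "v \<in> V" "v' \<in> V" and eq: "real_vec x = real_vec x'"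
          "int_hyperplane v x = int_hyperplane v' x'"
        have "v = v'" using par[OF v] int_hyperplane_eq_imp_parallel[OF eq(2)] by blast
        then show "x = x' \<and> v = v'" using eq(1) by (simp add: real_vec_inject)
      qed
      show "(\<lambda>(x, v). (real_vec x, int_hyperplane v x)) z
          \<in> {(p, h). p \<in> real_vec ` P \<and> h \<in> H0 \<union> K \<and> p \<in> h}" if "z \<in> P \<times> V" for z
        using that mem unfolding H0_def by auto
    qed
    then have inc: "n * w \<le> inc (real_vec ` P) (H0 \<union> K)" using P(2) V(2) by (simp add: card_cartesian_product)
    have "\<not> contains_Krr r (real_vec ` P) (H0 \<union> K)"
    proof (rule not_contains_Krr[where N = "real_vec ` V" and k = k])
      show "r > 0" unfolding r_def by simp
    next
      fix T a assume T: "T \<subseteq> real_vec ` P" "a \<in> real_vec ` P" "card T = r"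
      obtain T' a' where T': "T' \<subseteq> P" "T = real_vec ` T'" "a = real_vec a'"
        using T(1,2) by (metis imageE subset_imageE)
      have "card T = card T'" unfolding T'(2) by (rule card_image[OF inj_real_vec])
      then have "r1 \<le> card T'" using T(3) unfolding r_def by simp
      then show "k < dim ((\<lambda>x. x - a) ` T)"
        using Pdim[OF T'(1), of a'] unfolding T'(2,3) image_image by simp
    next
      fix U assume U: "U \<subseteq> real_vec ` V" "card U = r"
      obtain U' where U': "U' \<subseteq> V" "U = real_vec ` U'" using U(1) by (metis subset_imageE)
      have "card U = card U'" unfolding U'(2) by (rule card_image[OF inj_real_vec])
      then have "r2 \<le> card U'" using U(2) unfolding r_def by simp
      then show "CARD('n) - k \<le> dim U" unfolding U'(2) d_def[symmetric] by (rule Vdim[OF U'(1)])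
    next
      fix h x assume h: "h \<in> H0 \<union> K" and x: "x \<in> real_vec ` P" "x \<in> h"
      then have "h \<in> H0" using K_avoids by blast
      then obtain v z where "v \<in> V" "h = int_hyperplane v z" unfolding H0_def by blast
      then show "\<exists>v\<in>real_vec ` V. \<exists>c. h = {y. v \<bullet> y = c}"
        unfolding int_hyperplane_def by (intro bexI[of _ "real_vec v"] exI[of _ "real_vec v \<bullet> real_vec z"]) simp_all
    qed
    moreover have "card (real_vec ` P) = n" using card_image[OF inj_real_vec] P(2) by metis
    ultimately show ?thesis
      using inc cH fH0 K(1) P(1) hyp K(3)
      by (intro exI[of _ "real_vec ` P"] exI[of _ "H0 \<union> K"]) (simp add: ball_Un)
  qed
  show ?thesis
  proof (rule exI[of _ r], rule exI[of _ C], intro conjI allI impI C)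
    fix n w m :: nat
    assume *: "n \<ge> 1" "w \<ge> 1" "C * real n powr (1 / (real d - real k) + \<delta>)
      * real w powr (1 + (real d - 1) / (real d * (real k + 1)) + \<delta>) \<le> real m"
    show "\<exists>(P :: (real ^ 'n) set) H. finite P \<and> card P = n \<and> finite H \<and> card H = m \<and>
       (\<forall>h\<in>H. is_hyperplane h) \<and> \<not> contains_Krr r P H \<and> n * w \<le> inc P H"
      by (rule main[OF *(1,2)]) (use *(3) in \<open>simp only: a_def b_def add.assoc[symmetric]\<close>)
  qed
qed

text \<open>Covers the range where \<open>m\<close> is too small for the grid: the points of one
  coordinate axis all lie on the first of \<open>m\<close> parallel hyperplanes, and parallel
  hyperplanes share no point.\<close>

lemma exists_linear_incidences:
  fixes n m :: nat
  assumes d: "CARD('n::finite) \<ge> 2" and m: "m > 0"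
  shows "\<exists>(P :: (real ^ 'n) set) H. finite P \<and> card P = n \<and> finite H \<and> card H = m \<and>
       (\<forall>h\<in>H. is_hyperplane h) \<and> \<not> contains_Krr 2 P H \<and> n \<le> inc P H"
proof -
  define l0 where "l0 = (undefined :: 'n)"
  have "UNIV \<noteq> {l0}"
  proof
    assume "UNIV = {l0}"
    then have "CARD('n) = card {l0}" by simp
    then show False using d by simp
  qed
  then obtain l1 where l1: "l1 \<noteq> l0" by blast
  define g where "g t = {x :: real ^ 'n. x $ l0 = real t}" for t :: nat
  define f where "f i = (axis l1 (real i) :: real ^ 'n)" for i :: nat
  have g: "inj g"
  proof (rule injI)
    fix s t assume eq: "g s = g t"
    have "axis l0 (real s) \<in> g s" unfolding g_def by (simp add: axis_def)
    then show "s = t" unfolding eq by (simp add: g_def axis_def)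
  qed
  have f: "inj f" unfolding f_def by (rule injI) (auto simp: axis_eq_axis)
  have fg: "f i \<in> g 0" for i unfolding f_def g_def using l1 by (simp add: axis_def)
  have hyp: "is_hyperplane (g t)" for t
    unfolding is_hyperplane_def g_def
    by (intro exI[of _ "axis l0 1"] exI[of _ "real t"]) (simp add: inner_axis' axis_eq_0_iff)
  have inc: "card {..<n} \<le> inc (f ` {..<n}) (g ` {..<m})"
  proof (rule inc_ge)
    show "inj_on (\<lambda>i. (f i, g 0)) {..<n}" using f by (simp add: inj_on_def)
    show "(f i, g 0) \<in> {(p, h). p \<in> f ` {..<n} \<and> h \<in> g ` {..<m} \<and> p \<in> h}"
      if "i \<in> {..<n}" for i
      using that fg[of i] m by simp
  qed simp_all
  have Krr: "\<not> contains_Krr 2 (f ` {..<n}) (g ` {..<m})"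
  proof
    assume "contains_Krr 2 (f ` {..<n}) (g ` {..<m})"
    then obtain A B where AB: "B \<subseteq> g ` {..<m}" "card A = 2" "card B = 2" "\<forall>p\<in>A. \<forall>h\<in>B. p \<in> h"
      unfolding contains_Krr_def by blast
    obtain x where x: "x \<in> A" using AB(2) unfolding card_2_iff by blast
    obtain h h' where h: "h \<in> B" "h' \<in> B" "h \<noteq> h'" using AB(3) unfolding card_2_iff by blast
    obtain s t where st: "h = g s" "h' = g t" using AB(1) h(1,2) by blast
    have "x \<in> g s" "x \<in> g t" using AB(4) x h(1,2) st by blast+
    then have "s = t" unfolding g_def by simp
    then show False using h(3) st by simp
  qed
  show ?thesis
  proof (rule exI[of _ "f ` {..<n}"], rule exI[of _ "g ` {..<m}"], intro conjI)
    show "card (f ` {..<n}) = n"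
      using card_image[OF inj_on_subset[OF f subset_UNIV], of "{..<n}"] by (simp only: card_lessThan)
    show "card (g ` {..<m}) = m"
      using card_image[OF inj_on_subset[OF g subset_UNIV], of "{..<m}"] by (simp only: card_lessThan)
    show "\<forall>h\<in>g ` {..<m}. is_hyperplane h" by (rule ballI) (erule imageE, simp only: hyp)
    show "n \<le> inc (f ` {..<n}) (g ` {..<m})" using inc by (simp only: card_lessThan)
  qed (simp_all only: Krr not_False_eq_True finite_imageI finite_lessThan)
qed

section \<open>Choosing the number of normals\<close>

theorem theorem7:
  fixes k :: nat and \<epsilon> :: real
  defines "d \<equiv> CARD('n::finite)"
  assumes "k + 2 \<le> d" and "0 < \<epsilon>" and "\<epsilon> < 1"
  shows "\<exists>r::nat. \<exists>c::real. c > 0 \<and>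
    (\<forall>n m :: nat. n > 0 \<longrightarrow> m > 0 \<longrightarrow>
      (\<exists>(P :: (real ^ 'n) set) (H :: (real ^ 'n) set set).
         finite P \<and> card P = n \<and> finite H \<and> card H = m \<and>
         (\<forall>h\<in>H. is_hyperplane h) \<and>
         \<not> contains_Krr r P H \<and>
         real (inc P H) \<ge> c * (real n powr (1 - (real k + 1) / ((real k + 2 - 1 / real d) * (real d - real k)) - \<epsilon>))
                            * (real m powr (1 - (real d - 1) / (real d * real k + 2 * real d - 1) - \<epsilon>))))"
proof -
  define a where "a = 1 / (real d - real k)"
  define b where "b = (real d - 1) / (real d * (real k + 1))"
  \<comment> \<open>Reciprocal of the exponent of \<open>w\<close> in the grid condition, taken with
    slack \<open>\<epsilon>\<close>.\<close>
  define \<gamma> where "\<gamma> = 1 / (1 + b + \<epsilon>)"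
  define \<alpha> where "\<alpha> = (real k + 1) / ((real k + 2 - 1 / real d) * (real d - real k))"
  define \<beta> where "\<beta> = 1 - (real d - 1) / (real d * real k + 2 * real d - 1)"
  have d: "real d \<ge> 2" using assms(2) by simp
  have b0: "b \<ge> 0" unfolding b_def using d by simp
  have a0: "a > 0" unfolding a_def using assms(2) by simp
  have \<gamma>: "\<gamma> > 0" "\<gamma> \<le> 1 / (1 + b)" unfolding \<gamma>_def using b0 assms(3) by (auto intro!: divide_left_mono)
  define D where "D = real d * (real k + 1)"
  have D: "D > 0" unfolding D_def using d by simp
  have bD0: "(1 + b) * D = D + (real d - 1)"
    unfolding b_def D_def[symmetric] using D by (simp add: distrib_right)
  also have "D + (real d - 1) = real d * real k + 2 * real d - 1" unfolding D_def by (simp add: algebra_simps)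
  finally have bD: "(1 + b) * D = real d * real k + 2 * real d - 1" .
  \<comment> \<open>The denominator in the theorem is \<open>(1 + b) * (k + 1)\<close> in disguise,
    which makes \<open>\<alpha>\<close> equal to \<open>a / (1 + b)\<close>.\<close>
  have "real k + 2 - 1 / real d = (real d * real k + 2 * real d - 1) / real d"
    using d by (simp add: field_simps)
  also have "\<dots> = (1 + b) * (real k + 1)" unfolding bD[symmetric] D_def using d by simp
  finally have "\<alpha> = (real k + 1) / ((1 + b) * (real k + 1) * (real d - real k))" unfolding \<alpha>_def by simp
  then have \<alpha>: "\<alpha> = a / (1 + b)" unfolding a_def by simp
  have "\<beta> = 1 - (real d - 1) / ((1 + b) * D)" unfolding \<beta>_def bD ..
  also have "\<dots> = ((1 + b) * D - (real d - 1)) / ((1 + b) * D)"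
    using D b0 by (simp only: diff_divide_distrib) simp
  also have "(1 + b) * D - (real d - 1) = D" using bD0 by simp
  finally have \<beta>: "\<beta> = 1 / (1 + b)" using D by simp
  \<comment> \<open>The slack in the exponent of \<open>w\<close> costs at most
    \<open>\<epsilon>\<close> in that of \<open>m\<close>, both factors of the denominator being at
    least 1.\<close>
  have "1 / (1 + b) - \<gamma> = \<epsilon> / ((1 + b) * (1 + b + \<epsilon>))"
    unfolding \<gamma>_def using b0 assms(3) by (simp add: divide_simps)
  also have "\<dots> \<le> \<epsilon> / 1"
    using b0 assms(3) mult_mono[of 1 "1 + b" 1 "1 + b + \<epsilon>"] by (intro divide_left_mono) auto
  finally have \<beta>\<gamma>: "\<beta> - \<epsilon> \<le> \<gamma>" unfolding \<beta> by simp
  have "\<gamma> * (a + \<epsilon>) \<le> 1 / (1 + b) * (a + \<epsilon>)" using \<gamma> a0 assms(3) by (intro mult_right_mono) auto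
  also have "\<dots> = \<alpha> + \<epsilon> / (1 + b)" unfolding \<alpha> by (simp add: add_divide_distrib)
  also have "\<epsilon> / (1 + b) \<le> \<epsilon>" using b0 assms(3) by (simp add: divide_le_eq)
  finally have \<alpha>\<gamma>: "1 - \<alpha> - \<epsilon> \<le> 1 - \<gamma> * (a + \<epsilon>)" by simp
  obtain r1 C where C: "C \<ge> 1" and grid: "\<forall>n\<ge>1. \<forall>w\<ge>1. \<forall>m.
    C * real n powr (a + \<epsilon>) * real w powr (1 + b + \<epsilon>) \<le> real m \<longrightarrow>
    (\<exists>(P :: (real ^ 'n) set) H. finite P \<and> card P = n \<and> finite H \<and> card H = m \<and>
       (\<forall>h\<in>H. is_hyperplane h) \<and> \<not> contains_Krr r1 P H \<and> n * w \<le> inc P H)"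
    using exists_grid_incidences[OF assms(3) assms(2)[unfolded d_def], folded d_def, folded a_def b_def]
    by (elim exE conjE)
  define r where "r = max r1 2"
  \<comment> \<open>\<open>C powr \<gamma>\<close> undoes the constant inside \<open>Y\<close>; the
    2 pays for rounding \<open>Y powr \<gamma>\<close> down to the integer \<open>w\<close>.\<close>
  define c where "c = 1 / (2 * C powr \<gamma>)"
  have Cg: "C powr \<gamma> > 0" using C by simp
  have c: "c > 0" unfolding c_def using Cg by simp
  have main: "\<exists>(P :: (real ^ 'n) set) H. finite P \<and> card P = n \<and> finite H \<and> card H = m \<and>
       (\<forall>h\<in>H. is_hyperplane h) \<and> \<not> contains_Krr r P H \<and>
       c * real n powr (1 - \<alpha> - \<epsilon>) * real m powr (\<beta> - \<epsilon>) \<le> real (inc P H)"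
    if n: "n > 0" and m: "m > 0" for n m
  proof -
    \<comment> \<open>The grid condition reads \<open>w powr (1 + b + \<epsilon>) \<le> Y\<close>,
      so \<open>Y powr \<gamma>\<close> is the largest real value allowed for
      \<open>w\<close>.\<close>
    define Y where "Y = real m / (C * real n powr (a + \<epsilon>))"
    have Y0: "Y > 0" unfolding Y_def using n m C by simp
    have "real n powr (1 - \<alpha> - \<epsilon>) * real m powr (\<beta> - \<epsilon>)
        \<le> real n powr (1 - \<gamma> * (a + \<epsilon>)) * real m powr \<gamma>"
      using n m \<alpha>\<gamma> \<beta>\<gamma> by (intro mult_mono powr_mono) auto
    also have "\<dots> = real n * (real m powr \<gamma> / (real n powr (a + \<epsilon>)) powr \<gamma>)"
      using n by (simp add: powr_diff powr_powr mult.commute)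
    also have "\<dots> = real n * (C powr \<gamma> * Y powr \<gamma>)"
      unfolding Y_def using C n m by (simp add: powr_divide powr_mult)
    finally have "c * (real n powr (1 - \<alpha> - \<epsilon>) * real m powr (\<beta> - \<epsilon>))
        \<le> c * (real n * (C powr \<gamma> * Y powr \<gamma>))"
      using c by (intro mult_left_mono) auto
    also have "\<dots> = real n * (Y powr \<gamma> / 2)" unfolding c_def using Cg by simp
    finally have target: "c * real n powr (1 - \<alpha> - \<epsilon>) * real m powr (\<beta> - \<epsilon>) \<le> real n * (Y powr \<gamma> / 2)"
      by (simp add: mult.assoc)
    show ?thesis
    proof (cases "Y \<ge> 1")
      case True
      define w where "w = nat \<lfloor>Y powr \<gamma>\<rfloor>"
      have "Y powr \<gamma> \<ge> 1" using True \<gamma>(1) by (intro ge_one_powr_ge_zero) auto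
      then have "real w = of_int \<lfloor>Y powr \<gamma>\<rfloor>" "\<lfloor>Y powr \<gamma>\<rfloor> \<ge> 1" unfolding w_def by auto
      then have w: "w \<ge> 1" "real w \<le> Y powr \<gamma>" "Y powr \<gamma> / 2 \<le> real w" by linarith+
      have "real w powr (1 + b + \<epsilon>) \<le> (Y powr \<gamma>) powr (1 + b + \<epsilon>)"
        using w b0 assms(3) by (intro powr_mono2) auto
      also have "\<dots> = Y" unfolding powr_powr \<gamma>_def using b0 assms(3) Y0 by simp
      finally have "C * real n powr (a + \<epsilon>) * real w powr (1 + b + \<epsilon>) \<le> C * real n powr (a + \<epsilon>) * Y"
        using C by (intro mult_left_mono) auto
      also have "\<dots> = real m" unfolding Y_def using C n by simp
      finally obtain P :: "(real ^ 'n) set" and H where PH: "finite P" "card P = n" "finite H" "card H = m"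
         "\<forall>h\<in>H. is_hyperplane h" "\<not> contains_Krr r1 P H" "n * w \<le> inc P H"
        using grid n w(1) by (metis Suc_leI One_nat_def)
      have "\<not> contains_Krr r P H" using PH(6) contains_Krr_mono[of r P H r1] unfolding r_def by auto
      moreover have "real n * (Y powr \<gamma> / 2) \<le> real (n * w)"
        unfolding of_nat_mult using w(3) by (intro mult_left_mono) auto
      then have "c * real n powr (1 - \<alpha> - \<epsilon>) * real m powr (\<beta> - \<epsilon>) \<le> real (inc P H)"
        using PH(7) target by linarith
      ultimately show ?thesis using PH(1-5) by blast
    next
      case False
      \<comment> \<open>Not even \<open>w = 1\<close> is allowed here, but the target is at most
        \<open>n / 2\<close>, so linearly many incidences suffice.\<close>
      have "CARD('n) \<ge> 2" using assms(2) unfolding d_def by simp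
      then obtain P :: "(real ^ 'n) set" and H where PH: "finite P" "card P = n" "finite H" "card H = m"
         "\<forall>h\<in>H. is_hyperplane h" "\<not> contains_Krr 2 P H" "n \<le> inc P H"
        using exists_linear_incidences[OF _ m, of n, where 'n = 'n] by metis
      have "\<not> contains_Krr r P H" using PH(6) contains_Krr_mono[of r P H 2] unfolding r_def by auto
      moreover have "Y powr \<gamma> \<le> 1" using False Y0 \<gamma>(1) by (intro powr_le1) auto
      then have "real n * (Y powr \<gamma> / 2) \<le> real n * 1" by (intro mult_left_mono) auto
      then have "c * real n powr (1 - \<alpha> - \<epsilon>) * real m powr (\<beta> - \<epsilon>) \<le> real (inc P H)"
        using PH(7) target by linarith
      ultimately show ?thesis using PH(1-5) by blast
    qed
  qed
  have \<beta>\<epsilon>: "1 - (real d - 1) / (real d * real k + 2 * real d - 1) - \<epsilon> = \<beta> - \<epsilon>"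
    unfolding \<beta>_def ..
  show ?thesis
    unfolding \<beta>\<epsilon> \<alpha>_def[symmetric] using main c
    by (intro exI[of _ r] exI[of _ c] conjI allI impI) (auto simp only: mult.assoc)
qed

end
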